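(* There is an algorithm that, given a $k$-expression for an $n$-vertex graph $G$, computes, for every $\kappa$ with $0\le\kappa\le n$, the number of dominating sets of $G$ of size exactly $\kappa$, in $O(n^3 (k^2+i_\times(n))\, 4^k)$ time.
   Context: A dominating set of $G=(V,E)$ is a set $D\subseteq V$ such that every vertex not in $D$ has a neighbour in $D$. A $k$-expression is an expression built from the following operations on vertex-labelled graphs with labels in $\{1,\dots,k\}$: create a graph with a single vertex with a given label; relabel all vertices with label $i$ to label $j$ ($i\ne j$); add all edges between vertices with label $i$ and vertices with label $j$ ($i\ne j$); take the disjoint union of two labelled graphs. A $k$-expression for $G$ is one evaluating to a graph isomorphic to $G$. $i_\times(b)$ denotes the time to multiply two $b$-bit numbers. The model of computation is the RAM model with $O(k)$-bit word size, in which arithmetic on $O(k)$-bit numbers takes unit time.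
   Formalization: The time bound is claimed for k-expressions with O(nk²) operations (the usual convention); it cannot hold for arbitrarily long redundant k-expressions, since they must be read. The counts are correct for every k-expression. *)

theory Defs
  imports "HOL-Library.Log_Nat"
begin

section \<open>Graphs and dominating sets\<close>

record 'v graph =
  verts :: "'v set"
  edges :: "'v set set"

definition dominating :: "('v, 'm) graph_scheme \<Rightarrow> 'v set \<Rightarrow> bool" where
  "dominating G D \<longleftrightarrow>
     D \<subseteq> verts G \<and> (\<forall>v \<in> verts G - D. \<exists>u \<in> D. {u, v} \<in> edges G)"

definition num_dominating :: "('v, 'm) graph_scheme \<Rightarrow> nat \<Rightarrow> nat" where
  "num_dominating G \<kappa> = card {D. dominating G D \<and> card D = \<kappa>}"

definition isomorphic :: "('v, 'm) graph_scheme \<Rightarrow> ('w, 'l) graph_scheme \<Rightarrow> bool" where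
  "isomorphic G H \<longleftrightarrow>
     (\<exists>f. bij_betw f (verts G) (verts H) \<and> edges H = (\<lambda>e. f ` e) ` edges G)"


section \<open>Expressions over labelled graphs\<close>

datatype kexp =
    Vertex nat
  | Relabel nat nat kexp
  | Join nat nat kexp
  | Union kexp kexp

fun k_expression :: "nat \<Rightarrow> kexp \<Rightarrow> bool" where
  "k_expression k (Vertex i) \<longleftrightarrow> i \<in> {1..k}"
| "k_expression k (Relabel i j e) \<longleftrightarrow>
     i \<in> {1..k} \<and> j \<in> {1..k} \<and> i \<noteq> j \<and> k_expression k e"
| "k_expression k (Join i j e) \<longleftrightarrow>
     i \<in> {1..k} \<and> j \<in> {1..k} \<and> i \<noteq> j \<and> k_expression k e"
| "k_expression k (Union e e') \<longleftrightarrow> k_expression k e \<and> k_expression k e'"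

record 'v lgraph = "'v graph" +
  label :: "'v \<Rightarrow> nat"

text \<open>
  A vertex is named by the path leading to its creation in the expression tree, recording
  only the branches taken at disjoint unions; so the two sides of a union are made disjoint
  by prefixing \<^const>\<open>False\<close> and \<^const>\<open>True\<close>. The label function is only meaningful
  on the vertices.
\<close>

fun eval_kexp :: "kexp \<Rightarrow> bool list lgraph" where
  "eval_kexp (Vertex i) = \<lparr>verts = {[]}, edges = {}, label = (\<lambda>_. i)\<rparr>"
| "eval_kexp (Relabel i j e) =
     (let G = eval_kexp e
      in G\<lparr>label := (\<lambda>v. if label G v = i then j else label G v)\<rparr>)"
| "eval_kexp (Join i j e) =
     (let G = eval_kexp e
      in G\<lparr>edges := edges G \<union>
             {{u, v} | u v. u \<in> verts G \<and> v \<in> verts G \<and> label G u = i \<and> label G v = j}\<rparr>)"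
| "eval_kexp (Union e e') =
     (let G = eval_kexp e; H = eval_kexp e'
      in \<lparr>verts = (#) False ` verts G \<union> (#) True ` verts H,
          edges = (\<lambda>s. (#) False ` s) ` edges G \<union> (\<lambda>s. (#) True ` s) ` edges H,
          label = (\<lambda>v. if hd v then label H (tl v) else label G (tl v))\<rparr>)"

definition k_expression_for :: "nat \<Rightarrow> kexp \<Rightarrow> ('v, 'm) graph_scheme \<Rightarrow> bool" where
  "k_expression_for k e G \<longleftrightarrow> k_expression k e \<and> isomorphic (eval_kexp e) G"

fun num_ops :: "kexp \<Rightarrow> nat" where
  "num_ops (Vertex i) = 1"
| "num_ops (Relabel i j e) = num_ops e + 1"
| "num_ops (Join i j e) = num_ops e + 1"
| "num_ops (Union e e') = num_ops e + num_ops e' + 1"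


section \<open>Random access machines\<close>

text \<open>
  A program is a finite list of instructions with absolute jump targets; it stops when the
  program counter leaves the list. The machine has registers (a program can only mention
  finitely many of them) and a memory addressed indirectly through registers.
\<close>

datatype binop = Add | Sub | Mul | And | Shl | Shr

datatype instr =
    Const nat nat             \<comment> \<open>\<open>r := v\<close>\<close>
  | Op binop nat nat nat      \<comment> \<open>\<open>r := s \<circ> t\<close>\<close>
  | Load nat nat              \<comment> \<open>\<open>r := mem[s]\<close>\<close>
  | Store nat nat             \<comment> \<open>\<open>mem[r] := s\<close>\<close>
  | Jump nat
  | JumpZero nat nat          \<comment> \<open>\<open>if r = 0 then goto l\<close>\<close>

type_synonym program = "instr list"

record config =
  pc :: nat
  reg :: "nat \<Rightarrow> nat"
  mem :: "nat \<Rightarrow> nat"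

fun apply_op :: "binop \<Rightarrow> nat \<Rightarrow> nat \<Rightarrow> nat" where
  "apply_op Add x y = x + y"
| "apply_op Sub x y = x - y"
| "apply_op Mul x y = x * y"
| "apply_op And x y = and x y"
| "apply_op Shl x y = push_bit y x"
| "apply_op Shr x y = drop_bit y x"

fun step :: "instr \<Rightarrow> config \<Rightarrow> config" where
  "step (Const r v) s = s\<lparr>pc := pc s + 1, reg := (reg s)(r := v)\<rparr>"
| "step (Op f r a b) s =
     s\<lparr>pc := pc s + 1, reg := (reg s)(r := apply_op f (reg s a) (reg s b))\<rparr>"
| "step (Load r a) s = s\<lparr>pc := pc s + 1, reg := (reg s)(r := mem s (reg s a))\<rparr>"
| "step (Store r a) s = s\<lparr>pc := pc s + 1, mem := (mem s)(reg s r := reg s a)\<rparr>"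
| "step (Jump l) s = s\<lparr>pc := l\<rparr>"
| "step (JumpZero r l) s = s\<lparr>pc := (if reg s r = 0 then l else pc s + 1)\<rparr>"

text \<open>
  The word size \<open>w\<close> enters through the running time. A number of \<open>b\<close> bits occupies
  \<open>\<lceil>b / w\<rceil>\<close> words (at least one). Registers and memory cells may hold numbers of several
  words, and addresses may be several words long as well, but every instruction is charged
  for all words it handles; thus an instruction takes unit time if the numbers involved fit
  into single words. Multiplying two \<open>b\<close>-bit numbers takes time \<open>im w b\<close>.
\<close>

definition bits :: "nat \<Rightarrow> nat" where
  "bits x = floorlog 2 x"

definition words :: "nat \<Rightarrow> nat \<Rightarrow> nat" where
  "words w b = max 1 ((b + w - 1) div w)"

fun op_time :: "nat \<Rightarrow> (nat \<Rightarrow> nat \<Rightarrow> nat) \<Rightarrow> binop \<Rightarrow> nat \<Rightarrow> nat \<Rightarrow> nat" where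
  "op_time w im Mul x y = im w (max (bits x) (bits y))"
| "op_time w im f x y = words w (max (max (bits x) (bits y)) (bits (apply_op f x y)))"

fun instr_time :: "nat \<Rightarrow> (nat \<Rightarrow> nat \<Rightarrow> nat) \<Rightarrow> instr \<Rightarrow> config \<Rightarrow> nat" where
  "instr_time w im (Const r v) s = words w (bits v)"
| "instr_time w im (Op f r a b) s = op_time w im f (reg s a) (reg s b)"
| "instr_time w im (Load r a) s =
     words w (max (bits (reg s a)) (bits (mem s (reg s a))))"
| "instr_time w im (Store r a) s = words w (max (bits (reg s r)) (bits (reg s a)))"
| "instr_time w im (Jump l) s = 1"
| "instr_time w im (JumpZero r l) s = words w (bits (reg s r))"

text \<open>
  The admissible multiplication times: unit time on single words, monotone in the length of
  the numbers, and no faster than reading the operands.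
\<close>

definition multiplication_time :: "(nat \<Rightarrow> nat \<Rightarrow> nat) \<Rightarrow> bool" where
  "multiplication_time im \<longleftrightarrow>
     (\<forall>w \<ge> 1. (\<forall>b \<le> w. im w b = 1) \<and> mono (im w) \<and> (\<forall>b. words w b \<le> im w b))"

text \<open>\<open>runs w im P s t s'\<close>: started in \<open>s\<close>, program \<open>P\<close> halts in \<open>s'\<close> after time \<open>t\<close>.\<close>

inductive runs ::
  "nat \<Rightarrow> (nat \<Rightarrow> nat \<Rightarrow> nat) \<Rightarrow> program \<Rightarrow> config \<Rightarrow> nat \<Rightarrow> config \<Rightarrow> bool"
  for w im P where
  halted: "length P \<le> pc s \<Longrightarrow> runs w im P s 0 s"
| step: "pc s < length P \<Longrightarrow> runs w im P (step (P ! pc s) s) t s' \<Longrightarrow>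
     runs w im P s (instr_time w im (P ! pc s) s + t) s'"


section \<open>Input format\<close>

text \<open>
  The input is \<open>k\<close>, the number of operations, and the operations in postfix order, three
  cells each. All other cells and all registers are initially zero.
\<close>

fun postfix :: "kexp \<Rightarrow> nat list" where
  "postfix (Vertex i) = [0, i, 0]"
| "postfix (Relabel i j e) = postfix e @ [1, i, j]"
| "postfix (Join i j e) = postfix e @ [2, i, j]"
| "postfix (Union e e') = postfix e @ postfix e' @ [3, 0, 0]"

definition input :: "nat \<Rightarrow> kexp \<Rightarrow> nat list" where
  "input k e = k # num_ops e # postfix e"

definition initial :: "nat list \<Rightarrow> config" where
  "initial xs =
     \<lparr>pc = 0, reg = (\<lambda>_. 0), mem = (\<lambda>a. if a < length xs then xs ! a else 0)\<rparr>"

end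

theory Submission
  imports Defs
begin

text \<open>
  Dynamic programming along the expression. For sets \<open>X\<close>, \<open>Y\<close> of labels and a size \<open>\<kappa>\<close>, count the sets
  \<open>D\<close> of \<open>\<kappa>\<close> vertices such that all labels in \<open>D\<close> belong to \<open>X\<close> and all labels of vertices
  not dominated by \<open>D\<close> belong to \<open>Y\<close>. Since both conditions are closed under enlarging \<open>X\<close> and \<open>Y\<close>,
  a disjoint union becomes, for each of the \<open>4 ^ k\<close> pairs separately, a convolution in \<open>\<kappa>\<close>; this costs
  \<open>O(n ^ 2)\<close> multiplications of \<open>n\<close>-bit numbers per pair, and there are \<open>n - 1\<close> unions. Relabelling
  only moves entries. A join of \<open>i\<close> and \<open>j\<close> splits into two steps, each of which lets the vertices
  labelled \<open>i\<close> dominate those labelled \<open>j\<close> or conversely. One such step replaces \<open>f (X, Y)\<close> for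
  \<open>i \<in> X\<close> and \<open>j \<notin> Y\<close> by \<open>f (X, Y + j) - f (X - i, Y + j) + f (X - i, Y)\<close>. So relabellings and
  joins take time proportional to the table size, and no subset transform is ever needed.
\<close>

section \<open>Counting vertex sets by their labels\<close>

text \<open>The desired number is the count for \<open>X\<close> containing all labels and
  \<open>Y\<close> empty. A one-sided step is inclusion-exclusion on whether \<open>D\<close> meets
  label \<open>i\<close>: if it does, all vertices labelled \<open>j\<close> become dominated and
  \<open>Y + j\<close> may be used; the sets avoiding \<open>i\<close> are taken out again and
  recounted under their true condition. The cost model shapes the rest. A word has only
  \<open>c * k\<close> bits, a count has up to n bits, and a product may be charged at most
  \<open>im w n\<close>, so factors must stay strictly below \<open>2 ^ n\<close>. All other
  instructions handle numbers of O(n + k) bits, hence O(q) words for q = ceil(n / w). The estimate q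
  \<le> n turns O(n k^2) relabellings and joins on tables with O(n 4^k) entries into n^3 k^2 4^k;
  the estimate q \<le> \<open>im w n\<close> lets the additions and memory accesses of a union be
  charged to its multiplications. Tables can be updated in place because every source entry is
  either read before it changes or never changes at all.\<close>

text \<open>
  The number \<open>p\<close> encodes two sets of labels: bit \<open>a\<close> permits the label \<open>a\<close> inside \<open>D\<close>, and
  bit \<open>k + a\<close> permits it on undominated vertices; bit 0 is unused. The relation \<open>A u v\<close> (\<open>u\<close> dominates \<open>v\<close>) need
  not be symmetric, which allows to treat a join as two one-sided steps.
\<close>

definition allowed :: "nat \<Rightarrow> 'v set \<Rightarrow> ('v \<Rightarrow> nat) \<Rightarrow> ('v \<Rightarrow> 'v \<Rightarrow> bool) \<Rightarrow> nat \<Rightarrow> 'v set \<Rightarrow> bool" where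
  "allowed k V lab A p D \<longleftrightarrow> D \<subseteq> V \<and> (\<forall>v\<in>D. bit p (lab v)) \<and>
     (\<forall>v\<in>V - D. (\<forall>u\<in>D. \<not> A u v) \<longrightarrow> bit p (k + lab v))"

definition num_allowed :: "nat \<Rightarrow> 'v set \<Rightarrow> ('v \<Rightarrow> nat) \<Rightarrow> ('v \<Rightarrow> 'v \<Rightarrow> bool) \<Rightarrow> nat \<Rightarrow> nat \<Rightarrow> nat" where
  "num_allowed k V lab A \<kappa> p = card {D. allowed k V lab A p D \<and> card D = \<kappa>}"

lemma finite_allowed: "finite V \<Longrightarrow> finite {D. allowed k V lab A p D \<and> R D}"
  by (rule finite_subset[of _ "Pow V"]) (auto simp: allowed_def)

text \<open>As \<open>V\<close> is nonempty, \<open>{}\<close> and \<open>V\<close> differ in size,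
  so at least one subset of \<open>V\<close> is missed. Strictness makes every count an n-bit
  number, as needed for charging a product \<open>im w n\<close>.\<close>

lemma num_allowed_less:
  assumes "finite V" "V \<noteq> {}"
  shows "num_allowed k V lab A \<kappa> p < 2 ^ card V"
proof -
  have 1: "{D. allowed k V lab A p D \<and> card D = \<kappa>} \<subseteq> Pow V"
    by (auto simp: allowed_def)
  have "{D. allowed k V lab A p D \<and> card D = \<kappa>} \<subset> Pow V"
  proof (cases "\<kappa> = 0")
    case True
    with assms have "V \<notin> {D. allowed k V lab A p D \<and> card D = \<kappa>}" by auto
    moreover have "V \<in> Pow V" by simp
    ultimately show ?thesis using 1 by blast
  next
    case False
    then have "{} \<notin> {D. allowed k V lab A p D \<and> card D = \<kappa>}" by auto
    moreover have "{} \<in> Pow V" by simp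
    ultimately show ?thesis using 1 by blast
  qed
  then have "num_allowed k V lab A \<kappa> p < card (Pow V)"
    unfolding num_allowed_def using assms by (intro psubset_card_mono) auto
  then show ?thesis using assms by (simp add: card_Pow)
qed

text \<open>Labelling and code may change together, so a relabelling can be absorbed into a change
  of \<open>p\<close>.\<close>

lemma num_allowed_cong:
  assumes "\<And>v. v \<in> V \<Longrightarrow> bit p (lab v) = bit q (lab' v)"
    "\<And>v. v \<in> V \<Longrightarrow> bit p (k + lab v) = bit q (k + lab' v)"
    "\<And>u v. u \<in> V \<Longrightarrow> v \<in> V \<Longrightarrow> A u v = A' u v"
  shows "num_allowed k V lab A \<kappa> p = num_allowed k V lab' A' \<kappa> q"
proof -
  have "allowed k V lab A p D = allowed k V lab' A' q D" for D
    unfolding allowed_def using assms by (metis DiffD1 subset_iff)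
  then show ?thesis by (simp add: num_allowed_def)
qed

lemma num_allowed_singleton:
  assumes "\<not> A x x"
  shows "num_allowed k {x} lab A \<kappa> p =
    (if \<kappa> = 0 then of_bool (bit p (k + lab x)) else if \<kappa> = 1 then of_bool (bit p (lab x)) else 0)"
proof -
  have "{D. allowed k {x} lab A p D \<and> card D = \<kappa>} =
    (if \<kappa> = 0 \<and> bit p (k + lab x) then {{}} else {}) \<union> (if \<kappa> = 1 \<and> bit p (lab x) then {{x}} else {})"
    using assms by (auto simp: allowed_def subset_singleton_iff)
  then show ?thesis by (auto simp: num_allowed_def)
qed

text \<open>
  If \<open>D\<close> has a vertex with label \<open>i\<close>, the new arcs dominate all vertices with label \<open>j\<close>, so the
  bit \<open>k + j\<close> may as well be set; otherwise the new arcs have no effect.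
\<close>

lemma num_allowed_add_arcs:
  assumes fin: "finite V" and lab: "\<And>v. v \<in> V \<Longrightarrow> lab v \<in> {1..k}"
    and i: "i \<in> {1..k}" and j: "j \<in> {1..k}"
  shows "num_allowed k V lab (\<lambda>u v. A u v \<or> lab u = i \<and> lab v = j) \<kappa> p =
    (if bit p i \<and> \<not> bit p (k + j)
     then num_allowed k V lab A \<kappa> (set_bit (k + j) p)
        - num_allowed k V lab A \<kappa> (set_bit (k + j) (unset_bit i p))
        + num_allowed k V lab A \<kappa> (unset_bit i p)
     else num_allowed k V lab A \<kappa> p)" (is "num_allowed k V lab ?A \<kappa> p = _")
proof (cases "bit p i \<and> \<not> bit p (k + j)")
  case True
  let ?hit = "\<lambda>D. \<exists>u\<in>D. lab u = i"
  let ?p1 = "set_bit (k + j) p" and ?p2 = "unset_bit i p" and ?p3 = "set_bit (k + j) (unset_bit i p)"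
  let ?S = "\<lambda>A p. {D. allowed k V lab A p D \<and> card D = \<kappa>}"
  have bits: "bit ?p1 (lab v) = bit p (lab v)" "bit ?p2 (lab v) = (lab v \<noteq> i \<and> bit p (lab v))"
    "bit ?p3 (lab v) = (lab v \<noteq> i \<and> bit p (lab v))"
    "bit ?p1 (k + lab v) = (lab v = j \<or> bit p (k + lab v))"
    "bit ?p2 (k + lab v) = bit p (k + lab v)"
    "bit ?p3 (k + lab v) = (lab v = j \<or> bit p (k + lab v))" if "v \<in> V" for v
    using lab[OF that] i j by (auto simp: bit_set_bit_iff bit_unset_bit_iff)
  have 1: "allowed k V lab ?A p D = allowed k V lab A ?p1 D" if "?hit D" for D
  proof (cases "D \<subseteq> V")
    case sub: True
    have "(\<forall>v\<in>D. bit p (lab v)) = (\<forall>v\<in>D. bit ?p1 (lab v))"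
      using sub bits(1) by blast
    moreover have "((\<forall>u\<in>D. \<not> ?A u v) \<longrightarrow> bit p (k + lab v)) = ((\<forall>u\<in>D. \<not> A u v) \<longrightarrow> bit ?p1 (k + lab v))"
      if "v \<in> V" for v
      using bits(4)[OF that] \<open>?hit D\<close> by blast
    ultimately show ?thesis by (simp add: allowed_def)
  qed (simp add: allowed_def)
  have 2: "(allowed k V lab ?A p D \<and> \<not> ?hit D) = allowed k V lab A ?p2 D" for D
  proof (cases "D \<subseteq> V")
    case sub: True
    have "((\<forall>v\<in>D. bit p (lab v)) \<and> \<not> ?hit D) = (\<forall>v\<in>D. bit ?p2 (lab v))"
      using sub bits(2) by blast
    moreover have "(\<forall>v\<in>V - D. (\<forall>u\<in>D. \<not> ?A u v) \<longrightarrow> bit p (k + lab v)) =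
        (\<forall>v\<in>V - D. (\<forall>u\<in>D. \<not> A u v) \<longrightarrow> bit ?p2 (k + lab v))" if "\<not> ?hit D"
      using bits(5) that by simp
    ultimately show ?thesis unfolding allowed_def by argo
  qed (simp add: allowed_def)
  have 3: "(allowed k V lab A ?p1 D \<and> \<not> ?hit D) = allowed k V lab A ?p3 D" for D
  proof (cases "D \<subseteq> V")
    case sub: True
    have "((\<forall>v\<in>D. bit ?p1 (lab v)) \<and> \<not> ?hit D) = (\<forall>v\<in>D. bit ?p3 (lab v))"
      using sub bits(1,3) by blast
    moreover have "(\<forall>v\<in>V - D. (\<forall>u\<in>D. \<not> A u v) \<longrightarrow> bit ?p1 (k + lab v)) =
        (\<forall>v\<in>V - D. (\<forall>u\<in>D. \<not> A u v) \<longrightarrow> bit ?p3 (k + lab v))"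
      using bits(4,6) by simp
    ultimately show ?thesis unfolding allowed_def by argo
  qed (simp add: allowed_def)
  \<comment> \<open>Sets meeting label \<open>i\<close> are those allowed under \<open>?p1\<close>
    minus the ones avoiding \<open>i\<close>, which are exactly those for \<open>?p3\<close>; sets
    avoiding \<open>i\<close> are exactly those for \<open>?p2\<close>.\<close>
  have "?S ?A p = (?S A ?p1 - ?S A ?p3) \<union> ?S A ?p2"
  proof (intro set_eqI)
    fix D show "D \<in> ?S ?A p \<longleftrightarrow> D \<in> (?S A ?p1 - ?S A ?p3) \<union> ?S A ?p2"
      using 1[of D] 2[of D] 3[of D] by (cases "?hit D") auto
  qed
  moreover have "(?S A ?p1 - ?S A ?p3) \<inter> ?S A ?p2 = {}" using 2 3 1 by fastforce
  moreover have "?S A ?p3 \<subseteq> ?S A ?p1" using 3 by blast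
  ultimately show ?thesis
    using True finite_allowed[OF fin]
    by (simp add: num_allowed_def card_Un_disjoint card_Diff_subset)
next
  case False
  then have "allowed k V lab ?A p D = allowed k V lab A p D" for D
    by (auto simp: allowed_def)
  then show ?thesis unfolding if_not_P[OF False] num_allowed_def by simp
qed

lemma num_allowed_image:
  assumes "inj f"
  shows "num_allowed k (f ` V) lab A \<kappa> p = num_allowed k V (lab \<circ> f) (\<lambda>u v. A (f u) (f v)) \<kappa> p"
proof -
  have *: "allowed k (f ` V) lab A p (f ` D) = allowed k V (lab \<circ> f) (\<lambda>u v. A (f u) (f v)) p D" for D
    using assms by (auto simp: allowed_def inj_image_subset_iff inj_image_mem_iff simp flip: image_set_diff)
  have "{D. allowed k (f ` V) lab A p D \<and> card D = \<kappa>} =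
      (`) f ` {D. allowed k V (lab \<circ> f) (\<lambda>u v. A (f u) (f v)) p D \<and> card D = \<kappa>}" (is "?L = ?R")
  proof (intro equalityI subsetI)
    fix D assume D: "D \<in> ?L"
    then obtain E where "D = f ` E" by (auto simp: allowed_def subset_image_iff)
    with D show "D \<in> ?R"
      using assms by (auto simp: * card_image inj_on_subset[OF assms])
  qed (use assms in \<open>auto simp: * card_image inj_on_subset[OF assms]\<close>)
  then show ?thesis
    using inj_on_image_Pow[of f UNIV] assms by (simp add: num_allowed_def card_image inj_on_subset)
qed

text \<open>A set splits uniquely into its traces on \<open>V\<close> and \<open>W\<close>. No arc
  crosses, so whether a vertex is dominated depends on the trace on its own side, and
  \<open>p\<close> imposes a conjunction of conditions on single vertices; hence both sides are
  counted with the same \<open>p\<close>.\<close>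

lemma num_allowed_disjoint_union:
  assumes fin: "finite V" "finite W" and dis: "V \<inter> W = {}"
    and sep: "\<And>u v. u \<in> V \<Longrightarrow> v \<in> W \<Longrightarrow> \<not> A u v \<and> \<not> A v u"
  shows "num_allowed k (V \<union> W) lab A \<kappa> p =
    (\<Sum>a\<le>\<kappa>. num_allowed k V lab A a p * num_allowed k W lab A (\<kappa> - a) p)"
proof -
  let ?S = "\<lambda>V a. {D. allowed k V lab A p D \<and> card D = a}"
  have split: "allowed k (V \<union> W) lab A p (D \<union> E) \<longleftrightarrow> allowed k V lab A p D \<and> allowed k W lab A p E"
    if "D \<subseteq> V" "E \<subseteq> W" for D E
  proof -
    have 1: "v \<in> (V \<union> W) - (D \<union> E) \<longleftrightarrow> v \<in> V - D \<or> v \<in> W - E" for v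
      using that dis by blast
    have 2: "(\<forall>u\<in>D \<union> E. \<not> A u v) = (\<forall>u\<in>D. \<not> A u v)" if "v \<in> V" for v
      using that \<open>E \<subseteq> W\<close> sep by blast
    have 3: "(\<forall>u\<in>D \<union> E. \<not> A u v) = (\<forall>u\<in>E. \<not> A u v)" if "v \<in> W" for v
      using that \<open>D \<subseteq> V\<close> sep by blast
    have "(\<forall>v\<in>(V \<union> W) - (D \<union> E). (\<forall>u\<in>D \<union> E. \<not> A u v) \<longrightarrow> bit p (k + lab v)) \<longleftrightarrow>
        (\<forall>v\<in>V - D. (\<forall>u\<in>D. \<not> A u v) \<longrightarrow> bit p (k + lab v)) \<and>
        (\<forall>v\<in>W - E. (\<forall>u\<in>E. \<not> A u v) \<longrightarrow> bit p (k + lab v))"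
      unfolding Ball_def[of "(V \<union> W) - (D \<union> E)"] Ball_def[of "V - D"] Ball_def[of "W - E"] 1
      using 2 3 by blast
    then show ?thesis
      using that by (auto simp: allowed_def)
  qed
  have "bij_betw (\<lambda>(D, E). D \<union> E) (\<Union>a\<le>\<kappa>. ?S V a \<times> ?S W (\<kappa> - a)) (?S (V \<union> W) \<kappa>)"
  proof (rule bij_betw_byWitness[where f' = "\<lambda>D. (D \<inter> V, D \<inter> W)"])
    show "\<forall>x\<in>(\<Union>a\<le>\<kappa>. ?S V a \<times> ?S W (\<kappa> - a)).
        ((case x of (D, E) \<Rightarrow> D \<union> E) \<inter> V, (case x of (D, E) \<Rightarrow> D \<union> E) \<inter> W) = x"
      using dis by (auto simp: allowed_def)
    show "\<forall>D\<in>?S (V \<union> W) \<kappa>. (\<lambda>(D, E). D \<union> E) (D \<inter> V, D \<inter> W) = D"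
      by (auto simp: allowed_def)
    show "(\<lambda>(D, E). D \<union> E) ` (\<Union>a\<le>\<kappa>. ?S V a \<times> ?S W (\<kappa> - a)) \<subseteq> ?S (V \<union> W) \<kappa>"
    proof
      fix F assume "F \<in> (\<lambda>(D, E). D \<union> E) ` (\<Union>a\<le>\<kappa>. ?S V a \<times> ?S W (\<kappa> - a))"
      then obtain D E where F: "F = D \<union> E" and *: "card D \<le> \<kappa>" "allowed k V lab A p D"
        "allowed k W lab A p E" "card E = \<kappa> - card D"
        by auto
      then have "D \<subseteq> V" "E \<subseteq> W" by (auto simp: allowed_def)
      with * fin dis have "card (D \<union> E) = \<kappa>"
        by (subst card_Un_disjoint) (auto intro: finite_subset)
      then show "F \<in> ?S (V \<union> W) \<kappa>" unfolding F
        using * split \<open>D \<subseteq> V\<close> \<open>E \<subseteq> W\<close> by auto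
    qed
    show "(\<lambda>D. (D \<inter> V, D \<inter> W)) ` ?S (V \<union> W) \<kappa> \<subseteq> (\<Union>a\<le>\<kappa>. ?S V a \<times> ?S W (\<kappa> - a))"
    proof clarify
      fix D assume *: "allowed k (V \<union> W) lab A p D"
      then have D: "D = (D \<inter> V) \<union> (D \<inter> W)" by (auto simp: allowed_def)
      with * have "allowed k V lab A p (D \<inter> V)" "allowed k W lab A p (D \<inter> W)"
        using split[of "D \<inter> V" "D \<inter> W"] by auto
      moreover have "card D = card (D \<inter> V) + card (D \<inter> W)"
        by (subst D, subst card_Un_disjoint) (use fin dis in auto)
      ultimately show "(D \<inter> V, D \<inter> W) \<in> (\<Union>a\<le>card D. ?S V a \<times> ?S W (card D - a))"
        by (intro UN_I[of "card (D \<inter> V)"]) auto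
    qed
  qed
  then have "num_allowed k (V \<union> W) lab A \<kappa> p = card (\<Union>a\<le>\<kappa>. ?S V a \<times> ?S W (\<kappa> - a))"
    by (simp add: num_allowed_def bij_betw_same_card)
  also have "\<dots> = (\<Sum>a\<le>\<kappa>. card (?S V a \<times> ?S W (\<kappa> - a)))"
    using finite_allowed[OF fin(1)] finite_allowed[OF fin(2)] by (intro card_UN_disjoint) auto
  finally show ?thesis by (simp add: num_allowed_def card_cartesian_product)
qed

section \<open>Counts along an expression\<close>

definition expr_count :: "nat \<Rightarrow> kexp \<Rightarrow> nat \<Rightarrow> nat \<Rightarrow> nat" where
  "expr_count k e \<kappa> p = num_allowed k (verts (eval_kexp e)) (label (eval_kexp e))
     (\<lambda>u v. {u, v} \<in> edges (eval_kexp e)) \<kappa> p"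

text \<open>The pullback of \<open>p\<close> along the renaming of \<open>i\<close> to
  \<open>j\<close>: what is tested at \<open>i\<close> before the renaming is tested at
  \<open>j\<close> after it.\<close>

definition copy_bit :: "nat \<Rightarrow> nat \<Rightarrow> nat \<Rightarrow> nat" where
  "copy_bit i j p = (if bit p j then set_bit i p else unset_bit i p)"

text \<open>The right side of \<open>num_allowed_add_arcs\<close> as an operator on count functions;
  \<open>y\<close> is the bit \<open>k + j\<close> rather than a label.\<close>

definition arcs_update :: "nat \<Rightarrow> nat \<Rightarrow> (nat \<Rightarrow> nat) \<Rightarrow> nat \<Rightarrow> nat" where
  "arcs_update i y f p = (if bit p i \<and> \<not> bit p y
     then f (set_bit y p) - f (set_bit y (unset_bit i p)) + f (unset_bit i p) else f p)"

section \<open>Structure of evaluated expressions and recursions for their counts\<close>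

lemma bit_copy_bit: "bit (copy_bit i j p) n = (if n = i then bit p j else bit p n)" for p :: nat
  by (auto simp: copy_bit_def bit_set_bit_iff bit_unset_bit_iff)

lemma finite_verts: "finite (verts (eval_kexp e))"
  and verts_nonempty: "verts (eval_kexp e) \<noteq> {}"
  by (induction e) (auto simp: Let_def)

lemma label_bounds: "k_expression k e \<Longrightarrow> v \<in> verts (eval_kexp e) \<Longrightarrow> label (eval_kexp e) v \<in> {1..k}"
  by (induction e arbitrary: v) (auto simp: Let_def split: if_splits)

lemma edges_subset: "s \<in> edges (eval_kexp e) \<Longrightarrow> s \<subseteq> verts (eval_kexp e)"
proof (induction e arbitrary: s)
  case (Union e e')
  from Union.prems consider t where "t \<in> edges (eval_kexp e)" "s = (#) False ` t"
    | t where "t \<in> edges (eval_kexp e')" "s = (#) True ` t"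
    by (auto simp: Let_def)
  then show ?case
  proof cases
    case 1 with Union.IH(1)[of t] show ?thesis by (auto simp: Let_def)
  next
    case 2 with Union.IH(2)[of t] show ?thesis by (auto simp: Let_def)
  qed
qed (auto simp: Let_def)

lemma eval_kexp_sel [simp]:
  "verts (eval_kexp (Relabel i j e)) = verts (eval_kexp e)"
  "edges (eval_kexp (Relabel i j e)) = edges (eval_kexp e)"
  "label (eval_kexp (Relabel i j e)) =
     (\<lambda>v. if label (eval_kexp e) v = i then j else label (eval_kexp e) v)"
  "verts (eval_kexp (Join i j e)) = verts (eval_kexp e)"
  "edges (eval_kexp (Join i j e)) = edges (eval_kexp e) \<union> {{u, v} | u v. u \<in> verts (eval_kexp e) \<and>
     v \<in> verts (eval_kexp e) \<and> label (eval_kexp e) u = i \<and> label (eval_kexp e) v = j}"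
  "label (eval_kexp (Join i j e)) = label (eval_kexp e)"
  by (auto simp: Let_def)

declare eval_kexp.simps(2,3) [simp del]

fun num_leaves :: "kexp \<Rightarrow> nat" where
  "num_leaves (Vertex i) = 1"
| "num_leaves (Relabel i j e) = num_leaves e"
| "num_leaves (Join i j e) = num_leaves e"
| "num_leaves (Union e e') = num_leaves e + num_leaves e'"

lemma card_verts: "card (verts (eval_kexp e)) = num_leaves e"
proof (induction e)
  case (Union e e')
  have "card ((#) False ` verts (eval_kexp e) \<union> (#) True ` verts (eval_kexp e')) =
    card ((#) False ` verts (eval_kexp e)) + card ((#) True ` verts (eval_kexp e'))"
    by (rule card_Un_disjoint) (auto simp: finite_verts)
  with Union show ?case by (simp add: Let_def card_image)
qed (auto simp: Let_def)

lemma expr_count_less: "expr_count k e \<kappa> p < 2 ^ num_leaves e"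
  using num_allowed_less[OF finite_verts verts_nonempty] by (simp add: expr_count_def card_verts)

text \<open>Labels lie between 1 and \<open>k\<close>, so only bits up to \<open>2 * k\<close> are
  inspected. A whole table index can therefore stand in for \<open>p\<close>.\<close>

lemma expr_count_cong:
  assumes "k_expression k e" "\<And>a. a \<le> 2 * k \<Longrightarrow> bit p a = bit q a"
  shows "expr_count k e \<kappa> p = expr_count k e \<kappa> q"
proof -
  have "label (eval_kexp e) v \<le> 2 * k" "k + label (eval_kexp e) v \<le> 2 * k" if "v \<in> verts (eval_kexp e)" for v
    using label_bounds[OF assms(1) that] by auto
  then show ?thesis
    unfolding expr_count_def by (intro num_allowed_cong) (simp_all add: assms(2))
qed

lemma expr_count_Vertex:
  "expr_count k (Vertex i) \<kappa> p =
    (if \<kappa> = 0 then of_bool (bit p (k + i)) else if \<kappa> = 1 then of_bool (bit p i) else 0)"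
  by (simp add: expr_count_def num_allowed_singleton)

text \<open>Vertices labelled \<open>i\<close> are now tested at \<open>j\<close> and
  \<open>k + j\<close>. Since labels are at least 1, the bits for \<open>D\<close> and those for
  undominated vertices do not overlap, so the two copies do not interfere.\<close>

lemma expr_count_Relabel:
  assumes "k_expression k (Relabel i j e)"
  shows "expr_count k (Relabel i j e) \<kappa> p =
    expr_count k e \<kappa> (copy_bit (k + i) (k + j) (copy_bit i j p))"
proof -
  have ij: "i \<le> k" "j \<le> k" "i \<ge> 1" "j \<ge> 1" and e: "k_expression k e" using assms by auto
  show ?thesis
    unfolding expr_count_def eval_kexp_sel
  proof (rule num_allowed_cong)
    fix v assume "v \<in> verts (eval_kexp e)"
    then have "label (eval_kexp e) v \<ge> 1" "label (eval_kexp e) v \<le> k"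
      using label_bounds[OF e, of v] by auto
    with ij show "bit p (if label (eval_kexp e) v = i then j else label (eval_kexp e) v) =
        bit (copy_bit (k + i) (k + j) (copy_bit i j p)) (label (eval_kexp e) v)"
      "bit p (k + (if label (eval_kexp e) v = i then j else label (eval_kexp e) v)) =
        bit (copy_bit (k + i) (k + j) (copy_bit i j p)) (k + label (eval_kexp e) v)"
      by (auto simp: bit_copy_bit)
  qed simp
qed

lemma expr_count_Join:
  assumes "k_expression k (Join i j e)"
  shows "expr_count k (Join i j e) \<kappa> =
    arcs_update j (k + i) (arcs_update i (k + j) (expr_count k e \<kappa>))"
proof -
  let ?G = "eval_kexp e"
  let ?A = "\<lambda>u v. {u, v} \<in> edges ?G \<or> label ?G u = i \<and> label ?G v = j"
  have ij: "i \<in> {1..k}" "j \<in> {1..k}" and e: "k_expression k e" using assms by auto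
  note arcs = num_allowed_add_arcs[OF finite_verts label_bounds[OF e], folded arcs_update_def]
  have 1: "num_allowed k (verts ?G) (label ?G) ?A \<kappa> = arcs_update i (k + j) (expr_count k e \<kappa>)"
    unfolding expr_count_def by (rule ext, rule arcs) (use ij in auto)
  have "expr_count k (Join i j e) \<kappa> p =
      num_allowed k (verts ?G) (label ?G) (\<lambda>u v. ?A u v \<or> label ?G u = j \<and> label ?G v = i) \<kappa> p" for p
    unfolding expr_count_def eval_kexp_sel
    by (intro num_allowed_cong) (auto simp: doubleton_eq_iff)
  also have "\<dots> p = arcs_update j (k + i) (num_allowed k (verts ?G) (label ?G) ?A \<kappa>) p" for p
    by (rule arcs) (use ij in auto)
  finally show ?thesis unfolding 1 by blast
qed

text \<open>The first bit of a path identifies the side of a union, and prefixing is injective, so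
  each side keeps exactly its own edges.\<close>

lemma Cons_pair_in_image:
  "{b # u, b # v} \<in> (\<lambda>s. (#) b' ` s) ` S \<longleftrightarrow> b = b' \<and> {u, v} \<in> S"
proof
  assume "{b # u, b # v} \<in> (\<lambda>s. (#) b' ` s) ` S"
  then obtain s where s: "s \<in> S" "{b # u, b # v} = (#) b' ` s" by blast
  then have "b # u \<in> (#) b' ` s" by blast
  then have b: "b = b'" by auto
  with s have "(#) b' ` {u, v} = (#) b' ` s" by simp
  then have "{u, v} = s" by (subst (asm) inj_image_eq_iff) simp_all
  with s b show "b = b' \<and> {u, v} \<in> S" by simp
next
  assume *: "b = b' \<and> {u, v} \<in> S"
  then have "(#) b' ` {u, v} \<in> (\<lambda>s. (#) b' ` s) ` S" by blast
  with * show "{b # u, b # v} \<in> (\<lambda>s. (#) b' ` s) ` S" by simp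
qed

lemma expr_count_Union:
  "expr_count k (Union e e') \<kappa> p = (\<Sum>a\<le>\<kappa>. expr_count k e a p * expr_count k e' (\<kappa> - a) p)"
proof -
  let ?G = "eval_kexp (Union e e')"
  let ?V = "(#) False ` verts (eval_kexp e)" and ?W = "(#) True ` verts (eval_kexp e')"
  let ?E = "\<lambda>u v. {u, v} \<in> edges ?G"
  have "expr_count k (Union e e') \<kappa> p = num_allowed k (?V \<union> ?W) (label ?G) ?E \<kappa> p"
    by (simp add: expr_count_def Let_def)
  also have "\<dots> = (\<Sum>a\<le>\<kappa>. num_allowed k ?V (label ?G) ?E a p * num_allowed k ?W (label ?G) ?E (\<kappa> - a) p)"
  proof (rule num_allowed_disjoint_union)
    have hd: "hd x = hd y" if "s \<in> edges ?G" "x \<in> s" "y \<in> s" for s x y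
      using that by (auto simp: Let_def)
    show "\<not> ?E u v \<and> \<not> ?E v u" if "u \<in> ?V" "v \<in> ?W" for u v
      using hd[of "{u, v}" u v] hd[of "{v, u}" u v] that by auto
  qed (auto simp: finite_verts)
  finally have sum: "expr_count k (Union e e') \<kappa> p =
    (\<Sum>a\<le>\<kappa>. num_allowed k ?V (label ?G) ?E a p * num_allowed k ?W (label ?G) ?E (\<kappa> - a) p)" .
  have left: "num_allowed k ?V (label ?G) ?E a p = expr_count k e a p" for a
  proof -
    have *: "{False # u, False # v} \<in> edges ?G \<longleftrightarrow> {u, v} \<in> edges (eval_kexp e)" for u v
      using Cons_pair_in_image[of False u v] by (simp add: Let_def Un_iff)
    have "num_allowed k ?V (label ?G) ?E a p =
        num_allowed k (verts (eval_kexp e)) (label ?G \<circ> (#) False) (\<lambda>u v. ?E (False # u) (False # v)) a p"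
      by (rule num_allowed_image) simp
    also have "\<dots> = expr_count k e a p" unfolding expr_count_def
      by (rule num_allowed_cong) (simp_all add: * del: eval_kexp.simps, simp_all add: Let_def)
    finally show ?thesis .
  qed
  have right: "num_allowed k ?W (label ?G) ?E a p = expr_count k e' a p" for a
  proof -
    have *: "{True # u, True # v} \<in> edges ?G \<longleftrightarrow> {u, v} \<in> edges (eval_kexp e')" for u v
      using Cons_pair_in_image[of True u v] by (simp add: Let_def Un_iff)
    have "num_allowed k ?W (label ?G) ?E a p =
        num_allowed k (verts (eval_kexp e')) (label ?G \<circ> (#) True) (\<lambda>u v. ?E (True # u) (True # v)) a p"
      by (rule num_allowed_image) simp
    also have "\<dots> = expr_count k e' a p" unfolding expr_count_def
      by (rule num_allowed_cong) (simp_all add: * del: eval_kexp.simps, simp_all add: Let_def)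
    finally show ?thesis .
  qed
  show ?thesis unfolding sum left right ..
qed

section \<open>Tables indexed by size and label pair\<close>

text \<open>
  The index \<open>c = \<kappa> * 2 ^ (2 * k + 1) + p\<close> of a table of counts. The bits of \<open>p\<close> are bits of \<open>c\<close>, so
  \<open>p\<close> need not be extracted.
\<close>

definition entry :: "nat \<Rightarrow> kexp \<Rightarrow> nat \<Rightarrow> nat" where
  "entry k e c = expr_count k e (c div 2 ^ (2 * k + 1)) c"

text \<open>The quotient by \<open>2 ^ (2 * k + 1)\<close> is the size component of an index;
  changing lower bits keeps an index in the block of its size.\<close>

lemma div_eqI_bits:
  assumes "\<And>n. n \<ge> m \<Longrightarrow> bit x n = bit y n"
  shows "x div 2 ^ m = y div (2 ^ m :: nat)"
  unfolding drop_bit_eq_div[symmetric]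
  by (rule bit_eqI) (use assms in \<open>auto simp: bit_drop_bit_eq\<close>)

lemma entry_Relabel:
  assumes "k_expression k (Relabel i j e)"
  shows "entry k (Relabel i j e) c = entry k e (copy_bit (k + i) (k + j) (copy_bit i j c))"
proof -
  have "c div 2 ^ (2 * k + 1) = copy_bit (k + i) (k + j) (copy_bit i j c) div 2 ^ (2 * k + 1)"
    using assms by (intro div_eqI_bits) (auto simp: bit_copy_bit)
  then show ?thesis using assms by (simp add: entry_def expr_count_Relabel)
qed

text \<open>The update at \<open>c\<close> reads \<open>f\<close> only at \<open>c\<close> and at
  indices differing from \<open>c\<close> in bits up to \<open>2 * k\<close>. Agreement on the block
  of \<open>c\<close> suffices, so nothing is required of cells outside a table.\<close>

lemma arcs_update_cong:
  assumes "i \<le> 2 * k" "y \<le> 2 * k" "\<And>q. q div 2 ^ (2 * k + 1) = c div 2 ^ (2 * k + 1) \<Longrightarrow> f q = g q"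
  shows "arcs_update i y f c = arcs_update i y g c"
proof -
  have "set_bit y c div 2 ^ (2 * k + 1) = c div 2 ^ (2 * k + 1)"
    "set_bit y (unset_bit i c) div 2 ^ (2 * k + 1) = c div 2 ^ (2 * k + 1)"
    "unset_bit i c div 2 ^ (2 * k + 1) = c div 2 ^ (2 * k + 1)"
    using assms(1,2) by (intro div_eqI_bits; auto simp: bit_set_bit_iff bit_unset_bit_iff)+
  then show ?thesis using assms(3) by (simp add: arcs_update_def)
qed

text \<open>\<open>expr_count_Join\<close> keeps the size fixed, while \<open>entry\<close> decodes
  it from each index. On the block of \<open>c\<close> the two agree, and both one-sided updates
  stay inside this block.\<close>

lemma entry_Join:
  assumes "k_expression k (Join i j e)"
  shows "entry k (Join i j e) = arcs_update j (k + i) (arcs_update i (k + j) (entry k e))"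
proof
  fix c
  let ?f = "expr_count k e (c div 2 ^ (2 * k + 1))"
  have f: "?f q = entry k e q" if "q div 2 ^ (2 * k + 1) = c div 2 ^ (2 * k + 1)" for q
    unfolding entry_def that ..
  have "arcs_update i (k + j) ?f q = arcs_update i (k + j) (entry k e) q"
    if "q div 2 ^ (2 * k + 1) = c div 2 ^ (2 * k + 1)" for q
    using assms by (intro arcs_update_cong[of _ k] f) (auto simp only: that k_expression.simps atLeastAtMost_iff)
  then have "arcs_update j (k + i) (arcs_update i (k + j) ?f) c =
      arcs_update j (k + i) (arcs_update i (k + j) (entry k e)) c"
    by (rule arcs_update_cong[rotated 2]) (use assms in auto)
  then show "entry k (Join i j e) c = arcs_update j (k + i) (arcs_update i (k + j) (entry k e)) c"
    using assms by (simp add: entry_def expr_count_Join)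
qed

lemma entry_index:
  assumes "k_expression k e" "p < 2 ^ (2 * k + 1)"
  shows "entry k e (\<kappa> * 2 ^ (2 * k + 1) + p) = expr_count k e \<kappa> p"
proof -
  have low: "bit (\<kappa> * 2 ^ (2 * k + 1) + p) m = bit p m" if "m \<le> 2 * k" for m
  proof -
    have "take_bit (2 * k + 1) (\<kappa> * 2 ^ (2 * k + 1) + p) = take_bit (2 * k + 1) p"
      by (simp add: take_bit_eq_mod)
    then have "bit (take_bit (2 * k + 1) (\<kappa> * 2 ^ (2 * k + 1) + p)) m = bit (take_bit (2 * k + 1) p) m"
      by (rule arg_cong)
    then show ?thesis using that by (simp add: bit_take_bit_iff)
  qed
  have "(\<kappa> * 2 ^ (2 * k + 1) + p) div 2 ^ (2 * k + 1) = \<kappa>" using assms(2) by simp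
  then show ?thesis unfolding entry_def using expr_count_cong[OF assms(1) low] by simp
qed

lemma entry_Union:
  assumes "k_expression k (Union e e')" "p < 2 ^ (2 * k + 1)"
  shows "entry k (Union e e') (\<kappa> * 2 ^ (2 * k + 1) + p) =
    (\<Sum>a\<le>\<kappa>. entry k e (a * 2 ^ (2 * k + 1) + p) * entry k e' ((\<kappa> - a) * 2 ^ (2 * k + 1) + p))"
proof -
  have "k_expression k e" "k_expression k e'" using assms(1) by auto
  then show ?thesis
    by (simp only: entry_index[OF _ assms(2)] assms(1) expr_count_Union)
qed

text \<open>The mask sets the bits 0 to \<open>k\<close>: every label is permitted in
  \<open>D\<close> and none on an undominated vertex.\<close>

lemma num_dominating_eval:
  assumes "k_expression k e"
  shows "num_dominating (eval_kexp e) \<kappa> = expr_count k e \<kappa> (2 ^ (k + 1) - 1)"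
proof -
  have "bit (2 ^ (k + 1) - 1 :: nat) a \<longleftrightarrow> a \<le> k" for a
    using bit_mask_iff[where 'a = nat, of "k + 1" a] by (simp add: mask_eq_exp_minus_1 less_Suc_eq_le)
  moreover have "label (eval_kexp e) v \<le> k" "\<not> k + label (eval_kexp e) v \<le> k" if "v \<in> verts (eval_kexp e)" for v
    using label_bounds[OF assms that] by auto
  ultimately have "dominating (eval_kexp e) D =
      allowed k (verts (eval_kexp e)) (label (eval_kexp e)) (\<lambda>u v. {u, v} \<in> edges (eval_kexp e)) (2 ^ (k + 1) - 1) D" for D
    unfolding dominating_def allowed_def by blast
  then show ?thesis by (simp add: num_dominating_def expr_count_def num_allowed_def)
qed

text \<open>The map is injective only on \<open>verts G\<close>, and edges are transported as images
  of sets; \<open>sub\<close> makes it possible to recover an edge from its image.\<close>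

lemma num_dominating_isomorphic:
  assumes "isomorphic G H" and sub: "\<And>s. s \<in> edges G \<Longrightarrow> s \<subseteq> verts G"
  shows "num_dominating H \<kappa> = num_dominating G \<kappa>"
proof -
  obtain f where f: "bij_betw f (verts G) (verts H)" and E: "edges H = (\<lambda>e. f ` e) ` edges G"
    using assms(1) by (auto simp: isomorphic_def)
  have inj: "inj_on f (verts G)" and im: "verts H = f ` verts G" using f by (auto simp: bij_betw_def)
  have edge: "{f u, f v} \<in> edges H \<longleftrightarrow> {u, v} \<in> edges G" if "u \<in> verts G" "v \<in> verts G" for u v
  proof
    assume "{f u, f v} \<in> edges H"
    then obtain s where s: "s \<in> edges G" "f ` s = f ` {u, v}" by (auto simp: E)
    with sub inj that have "s = {u, v}"
      by (intro inj_on_image_eq_iff[THEN iffD1, OF inj]) auto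
    with s show "{u, v} \<in> edges G" by simp
  next
    assume "{u, v} \<in> edges G"
    then have "f ` {u, v} \<in> edges H" unfolding E by (rule imageI)
    then show "{f u, f v} \<in> edges H" by simp
  qed
  have dom: "dominating H (f ` D) \<longleftrightarrow> dominating G D" if "D \<subseteq> verts G" for D
  proof -
    have "verts H - f ` D = f ` (verts G - D)"
      using inj that by (simp add: im inj_on_image_set_diff)
    then have "dominating H (f ` D) \<longleftrightarrow> (\<forall>v\<in>verts G - D. \<exists>u\<in>D. {f u, f v} \<in> edges H)"
      using that by (auto simp: dominating_def im)
    also have "\<dots> \<longleftrightarrow> dominating G D"
    proof -
      have "{f u, f v} \<in> edges H \<longleftrightarrow> {u, v} \<in> edges G" if "u \<in> D" "v \<in> verts G - D" for u v
        using that \<open>D \<subseteq> verts G\<close> by (intro edge) auto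
      then show ?thesis using that by (simp add: dominating_def)
    qed
    finally show ?thesis .
  qed
  have "{D. dominating H D \<and> card D = \<kappa>} = (`) f ` {D. dominating G D \<and> card D = \<kappa>}"
  proof (intro equalityI subsetI)
    fix D assume D: "D \<in> {D. dominating H D \<and> card D = \<kappa>}"
    then obtain D' where "D' \<subseteq> verts G" "D = f ` D'"
      by (auto simp: dominating_def im subset_image_iff)
    with D dom show "D \<in> (`) f ` {D. dominating G D \<and> card D = \<kappa>}"
      by (auto simp: card_image inj_on_subset[OF inj])
  next
    fix D assume "D \<in> (`) f ` {D. dominating G D \<and> card D = \<kappa>}"
    then obtain D' where "D = f ` D'" "dominating G D'" "card D' = \<kappa>" by auto
    moreover from this have "D' \<subseteq> verts G" by (simp add: dominating_def)
    ultimately show "D \<in> {D. dominating H D \<and> card D = \<kappa>}"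
      by (simp add: dom card_image inj_on_subset[OF inj])
  qed
  moreover have "inj_on ((`) f) {D. dominating G D \<and> card D = \<kappa>}"
    using inj_on_image_eq_iff[OF inj] by (auto simp: inj_on_def dominating_def)
  ultimately show ?thesis by (simp add: num_dominating_def card_image)
qed

section \<open>Structured programs with running times\<close>

datatype com =
    Block "instr list"
  | Seq com com (infixr ";;" 60)
  | While nat com
  | Cond nat com com

primrec csize :: "com \<Rightarrow> nat" where
  "csize (Block is) = length is"
| "csize (c ;; d) = csize c + csize d"
| "csize (While r c) = csize c + 2"
| "csize (Cond r c d) = csize c + csize d + 2"

primrec compile :: "com \<Rightarrow> nat \<Rightarrow> program" where
  "compile (Block is) l = is"
| "compile (c ;; d) l = compile c l @ compile d (l + csize c)"
| "compile (While r c) l = JumpZero r (l + csize c + 2) # compile c (l + 1) @ [Jump l]"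
| "compile (Cond r c d) l = JumpZero r (l + csize c + 2) # compile c (l + 1) @
     Jump (l + csize c + csize d + 2) # compile d (l + csize c + 2)"

lemma length_compile [simp]: "length (compile c l) = csize c"
  by (induction c arbitrary: l) auto

definition code_at :: "program \<Rightarrow> nat \<Rightarrow> program \<Rightarrow> bool" where
  "code_at P l is \<longleftrightarrow> (\<exists>xs ys. P = xs @ is @ ys \<and> length xs = l)"

lemma code_at_append:
  "code_at P l (is @ js) \<Longrightarrow> code_at P l is \<and> code_at P (l + length is) js"
proof -
  assume "code_at P l (is @ js)"
  then obtain xs ys where P: "P = xs @ (is @ js) @ ys" "length xs = l" by (auto simp: code_at_def)
  then have "P = xs @ is @ (js @ ys)" "P = (xs @ is) @ js @ ys" "length (xs @ is) = l + length is" by simp_all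
  with P show ?thesis unfolding code_at_def by blast
qed

lemma code_at_Cons:
  assumes "code_at P l (i # is)"
  shows "l < length P" "P ! l = i" "code_at P (l + 1) is"
proof -
  obtain xs ys where P: "P = xs @ (i # is) @ ys" and l: "length xs = l"
    using assms by (auto simp: code_at_def)
  from l show "l < length P" "P ! l = i" unfolding P by auto
  show "code_at P (l + 1) is"
    using code_at_append[of P l "[i]" "is"] assms by simp
qed

abbreviation cfg :: "nat \<Rightarrow> (nat \<Rightarrow> nat) \<Rightarrow> (nat \<Rightarrow> nat) \<Rightarrow> config" where
  "cfg l rg m \<equiv> \<lparr>pc = l, reg = rg, mem = m\<rparr>"

type_synonym assn = "(nat \<Rightarrow> nat) \<Rightarrow> (nat \<Rightarrow> nat) \<Rightarrow> bool"

section \<open>Instruction costs and timed Hoare triples\<close>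

lemma words_mono: "a \<le> b \<Longrightarrow> words w a \<le> words w b"
  unfolding words_def by (intro max.mono div_le_mono) auto

lemma words_ge_1: "words w b \<ge> 1"
  by (simp add: words_def)

lemma bits_le_iff: "bits x \<le> b \<longleftrightarrow> x < 2 ^ b"
  by (simp add: bits_def floorlog_le_iff)

text \<open>
  All numbers stay below \<open>2 ^ B\<close>, and the factors of products even below \<open>2 ^ N\<close>, since \<open>im w\<close> is not
  controlled beyond \<open>n\<close> bits.
\<close>

locale machine =
  fixes w :: nat and im :: "nat \<Rightarrow> nat \<Rightarrow> nat" and B N :: nat
  assumes w: "w \<ge> 1" and im: "multiplication_time im"
begin

definition unit_cost :: nat where "unit_cost = words w B"
definition mul_cost :: nat where "mul_cost = im w N"

definition small :: assn where
  "small rg m \<longleftrightarrow> (\<forall>r. rg r < 2 ^ B) \<and> (\<forall>a. m a < 2 ^ B)"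

text \<open>\<open>Sub\<close>, \<open>And\<close> and \<open>Shr\<close> never exceed their first
  operand, so only the growing operations carry a size condition.\<close>

fun op_ok :: "binop \<Rightarrow> nat \<Rightarrow> nat \<Rightarrow> bool" where
  "op_ok Mul x y \<longleftrightarrow> x < 2 ^ N \<and> y < 2 ^ N \<and> x * y < 2 ^ B"
| "op_ok Add x y \<longleftrightarrow> x + y < 2 ^ B"
| "op_ok Shl x y \<longleftrightarrow> push_bit y x < 2 ^ B"
| "op_ok _ x y \<longleftrightarrow> True"

text \<open>Blocks are straight-line: control instructions are rejected, so jumps arise only from
  \<open>compile\<close>. Size conditions are imposed where values are created; loads and stores
  merely move values already known to be small.\<close>

fun wp :: "instr list \<Rightarrow> (nat \<Rightarrow> nat) \<Rightarrow> (nat \<Rightarrow> nat) \<Rightarrow> assn \<Rightarrow> bool" where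
  "wp [] rg m Q \<longleftrightarrow> Q rg m"
| "wp (Const r v # is) rg m Q \<longleftrightarrow> v < 2 ^ B \<and> wp is (rg(r := v)) m Q"
| "wp (Op f r a b # is) rg m Q \<longleftrightarrow>
     op_ok f (rg a) (rg b) \<and> wp is (rg(r := apply_op f (rg a) (rg b))) m Q"
| "wp (Load r a # is) rg m Q \<longleftrightarrow> wp is (rg(r := m (rg a))) m Q"
| "wp (Store r a # is) rg m Q \<longleftrightarrow> wp is rg (m(rg r := rg a)) Q"
| "wp (Jump l # is) rg m Q \<longleftrightarrow> False"
| "wp (JumpZero r l # is) rg m Q \<longleftrightarrow> False"

fun instr_cost :: "instr \<Rightarrow> nat" where
  "instr_cost (Op Mul r a b) = mul_cost"
| "instr_cost i = unit_cost"

text \<open>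
  The clause on \<^const>\<open>runs\<close> quantifies over all continuations, so that triples compose without
  a separate semantics of the structured language.
\<close>

definition triple :: "com \<Rightarrow> (nat \<Rightarrow> nat) \<Rightarrow> (nat \<Rightarrow> nat) \<Rightarrow> nat \<Rightarrow> assn \<Rightarrow> bool" where
  "triple c rg m T Q \<longleftrightarrow> (small rg m \<longrightarrow> (\<forall>P l. code_at P l (compile c l) \<longrightarrow>
     (\<exists>t rg' m'. t \<le> T \<and> small rg' m' \<and> Q rg' m' \<and>
       (\<forall>t' s'. runs w im P (cfg (l + csize c) rg' m') t' s' \<longrightarrow>
          runs w im P (cfg l rg m) (t + t') s'))))"

lemma unit_cost_ge_1: "unit_cost \<ge> 1"
  unfolding unit_cost_def by (rule words_ge_1)

lemma words_le_unit_cost: "x < 2 ^ B \<Longrightarrow> words w (bits x) \<le> unit_cost"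
  unfolding unit_cost_def by (rule words_mono, unfold bits_le_iff)

lemma words_max_le: "words w a \<le> c \<Longrightarrow> words w b \<le> c \<Longrightarrow> words w (max a b) \<le> c"
  by (simp add: max_def)

lemma mul_cost: "x < 2 ^ N \<Longrightarrow> y < 2 ^ N \<Longrightarrow> im w (max (bits x) (bits y)) \<le> mul_cost"
proof -
  assume "x < 2 ^ N" "y < 2 ^ N"
  then have "max (bits x) (bits y) \<le> N" by (simp add: bits_le_iff)
  then show ?thesis
    using im w unfolding mul_cost_def multiplication_time_def mono_def by blast
qed

lemma drop_bit_le: "drop_bit y x \<le> (x :: nat)"
  by (simp add: drop_bit_eq_div)

lemma and_le: "and x y \<le> (x :: nat)"
proof -
  have "and (int x) (int y) \<le> int x" by (rule AND_upper1) simp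
  then show ?thesis by (metis of_nat_and_eq of_nat_le_iff)
qed

lemma wp_step:
  assumes "small rg m" "wp (i # is) rg m Q"
  obtains rg' m' where "step i (cfg l rg m) = cfg (l + 1) rg' m'" "small rg' m'" "wp is rg' m' Q"
    "instr_time w im i (cfg l rg m) \<le> instr_cost i"
proof -
  have R: "rg r < 2 ^ B" "m r < 2 ^ B" for r using assms(1) by (auto simp: small_def)
  show thesis
  proof (cases i)
    case [simp]: (Const r v)
    show thesis by (rule that[of "rg(r := v)" m])
        (use assms in \<open>auto simp: small_def words_le_unit_cost\<close>)
  next
    case [simp]: (Op f r a b)
    let ?v = "apply_op f (rg a) (rg b)"
    have v: "?v < 2 ^ B" using assms(2) R drop_bit_le[of "rg b" "rg a"] and_le[of "rg a" "rg b"]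
      by (cases f) (auto intro: le_less_trans less_imp_diff_less)
    have "op_time w im f (rg a) (rg b) \<le> instr_cost i"
      using assms(2) R v by (cases f) (auto simp: mul_cost intro!: words_max_le words_le_unit_cost)
    then show thesis by (intro that[of "rg(r := ?v)" m])
        (use assms v in \<open>auto simp: small_def\<close>)
  next
    case [simp]: (Load r a)
    show thesis by (rule that[of "rg(r := m (rg a))" m])
        (use assms R in \<open>auto simp: small_def intro!: words_max_le words_le_unit_cost\<close>)
  next
    case [simp]: (Store r a)
    show thesis by (rule that[of rg "m(rg r := rg a)"])
        (use assms R in \<open>auto simp: small_def intro!: words_max_le words_le_unit_cost\<close>)
  qed (use assms in auto)
qed

lemma runs_step:
  assumes "runs w im P (step (P ! l) (cfg l rg m)) t' s'" "l < length P"
  shows "runs w im P (cfg l rg m) (instr_time w im (P ! l) (cfg l rg m) + t') s'"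
  using runs.step[of "cfg l rg m" P w im t' s'] assms by simp

lemma triple_Block:
  "wp is rg m Q \<Longrightarrow> triple (Block is) rg m (\<Sum>i\<leftarrow>is. instr_cost i) Q"
proof (induction "is" arbitrary: rg m)
  case Nil
  then show ?case
    unfolding triple_def by (intro impI allI exI[of _ 0] exI[of _ rg] exI[of _ m]) simp
next
  case (Cons i "is")
  show ?case
    unfolding triple_def
  proof (intro impI allI)
    fix P l assume small: "small rg m" and code: "code_at P l (compile (Block (i # is)) l)"
    obtain rg1 m1 where 1: "step i (cfg l rg m) = cfg (l + 1) rg1 m1" "small rg1 m1" "wp is rg1 m1 Q"
      "instr_time w im i (cfg l rg m) \<le> instr_cost i"
      using wp_step[OF small Cons.prems] by metis
    have P: "l < length P" "P ! l = i" "code_at P (l + 1) is"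
      using code code_at_Cons[of P l i "is"] by auto
    from Cons.IH[OF 1(3)] 1(2) P(3) obtain t rg2 m2 where 2: "t \<le> (\<Sum>i\<leftarrow>is. instr_cost i)" "small rg2 m2"
      "Q rg2 m2" "\<And>t' s'. runs w im P (cfg (l + 1 + length is) rg2 m2) t' s' \<Longrightarrow>
        runs w im P (cfg (l + 1) rg1 m1) (t + t') s'"
      unfolding triple_def compile.simps csize.simps by blast
    have "runs w im P (cfg l rg m) (instr_time w im i (cfg l rg m) + t + t') s'"
      if "runs w im P (cfg (l + csize (Block (i # is))) rg2 m2) t' s'" for t' s'
      using runs_step[of P l rg m "t + t'" s'] 2(4)[of t' s'] that P 1(1) by (simp add: add.assoc)
    then show "\<exists>t rg' m'. t \<le> (\<Sum>i\<leftarrow>i # is. instr_cost i) \<and> small rg' m' \<and> Q rg' m' \<and>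
       (\<forall>t' s'. runs w im P (cfg (l + csize (Block (i # is))) rg' m') t' s' \<longrightarrow>
          runs w im P (cfg l rg m) (t + t') s')"
      using 1(4) 2(1-3) by (intro exI[of _ "instr_time w im i (cfg l rg m) + t"] exI[of _ rg2] exI[of _ m2]) auto
  qed
qed

lemma tripleE:
  assumes "triple c rg m T Q" "small rg m" "code_at P l (compile c l)"
  obtains t rg' m' where "t \<le> T" "small rg' m'" "Q rg' m'"
    "\<And>t' s'. runs w im P (cfg (l + csize c) rg' m') t' s' \<Longrightarrow> runs w im P (cfg l rg m) (t + t') s'"
  using assms unfolding triple_def by blast

lemma tripleI:
  assumes "\<And>P l. small rg m \<Longrightarrow> code_at P l (compile c l) \<Longrightarrow> \<exists>t rg' m'. t \<le> T \<and> small rg' m' \<and> Q rg' m' \<and>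
    (\<forall>t' s'. runs w im P (cfg (l + csize c) rg' m') t' s' \<longrightarrow> runs w im P (cfg l rg m) (t + t') s')"
  shows "triple c rg m T Q"
  using assms unfolding triple_def by blast

lemma triple_weaken:
  assumes "triple c rg m T R" "T \<le> T'" "\<And>rg' m'. R rg' m' \<Longrightarrow> Q rg' m'"
  shows "triple c rg m T' Q"
proof (rule tripleI)
  fix P l assume "small rg m" "code_at P l (compile c l)"
  with assms(1) show "\<exists>t rg' m'. t \<le> T' \<and> small rg' m' \<and> Q rg' m' \<and>
    (\<forall>t' s'. runs w im P (cfg (l + csize c) rg' m') t' s' \<longrightarrow> runs w im P (cfg l rg m) (t + t') s')"
    by (elim tripleE) (use assms(2,3) le_trans in blast)+
qed

lemma triple_Seq:
  assumes "triple c rg m T1 R" "\<And>rg' m'. R rg' m' \<Longrightarrow> triple d rg' m' T2 Q"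
  shows "triple (c ;; d) rg m (T1 + T2) Q"
proof (rule tripleI)
  fix P l assume small: "small rg m" and "code_at P l (compile (c ;; d) l)"
  then have code: "code_at P l (compile c l)" "code_at P (l + csize c) (compile d (l + csize c))"
    using code_at_append[of P l "compile c l"] by auto
  obtain t1 rg1 m1 where 1: "t1 \<le> T1" "small rg1 m1" "R rg1 m1"
    "\<And>t' s'. runs w im P (cfg (l + csize c) rg1 m1) t' s' \<Longrightarrow> runs w im P (cfg l rg m) (t1 + t') s'"
    using tripleE[OF assms(1) small code(1)] by metis
  obtain t2 rg2 m2 where 2: "t2 \<le> T2" "small rg2 m2" "Q rg2 m2"
    "\<And>t' s'. runs w im P (cfg (l + csize c + csize d) rg2 m2) t' s' \<Longrightarrow>
      runs w im P (cfg (l + csize c) rg1 m1) (t2 + t') s'"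
    using tripleE[OF assms(2)[OF 1(3)] 1(2) code(2)] by metis
  show "\<exists>t rg' m'. t \<le> T1 + T2 \<and> small rg' m' \<and> Q rg' m' \<and>
    (\<forall>t' s'. runs w im P (cfg (l + csize (c ;; d)) rg' m') t' s' \<longrightarrow> runs w im P (cfg l rg m) (t + t') s')"
    using 1 2 by (intro exI[of _ "t1 + t2"] exI[of _ rg2] exI[of _ m2]) (simp add: add.assoc)
qed

text \<open>The extra cost pays for the test and for the jump over the second branch; a jump costs
  1, which is at most \<open>unit_cost\<close>.\<close>

lemma triple_Cond:
  assumes "rg r \<noteq> 0 \<Longrightarrow> triple c rg m T Q" "rg r = 0 \<Longrightarrow> triple d rg m T Q"
  shows "triple (Cond r c d) rg m (T + 2 * unit_cost) Q"
proof (rule tripleI)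
  fix P l assume small: "small rg m" and code: "code_at P l (compile (Cond r c d) l)"
  let ?J = "Jump (l + csize c + csize d + 2)"
  have head: "l < length P" "P ! l = JumpZero r (l + csize c + 2)"
    and tail: "code_at P (l + 1) (compile c (l + 1) @ ?J # compile d (l + csize c + 2))"
    using code_at_Cons code unfolding compile.simps by blast+
  have c: "code_at P (l + 1) (compile c (l + 1))"
    and tail2: "code_at P (l + 1 + csize c) (?J # compile d (l + csize c + 2))"
    using code_at_append[OF tail] by auto
  have jump: "l + 1 + csize c < length P" "P ! (l + 1 + csize c) = ?J"
    and d: "code_at P (l + csize c + 2) (compile d (l + csize c + 2))"
    using code_at_Cons[OF tail2] by (auto simp: numeral_2_eq_2)
  have test: "words w (bits (rg r)) \<le> unit_cost"
    using small by (intro words_le_unit_cost) (simp add: small_def)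
  show "\<exists>t rg' m'. t \<le> T + 2 * unit_cost \<and> small rg' m' \<and> Q rg' m' \<and>
    (\<forall>t' s'. runs w im P (cfg (l + csize (Cond r c d)) rg' m') t' s' \<longrightarrow> runs w im P (cfg l rg m) (t + t') s')"
  proof (cases "rg r = 0")
    case True
    obtain t rg1 m1 where 1: "t \<le> T" "small rg1 m1" "Q rg1 m1"
      "\<And>t' s'. runs w im P (cfg (l + csize c + 2 + csize d) rg1 m1) t' s' \<Longrightarrow>
        runs w im P (cfg (l + csize c + 2) rg m) (t + t') s'"
      using tripleE[OF assms(2)[OF True] small d] by metis
    have "runs w im P (cfg l rg m) (words w (bits (rg r)) + t + t') s'"
      if "runs w im P (cfg (l + csize (Cond r c d)) rg1 m1) t' s'" for t' s'
      using runs_step[of P l rg m "t + t'" s'] 1(4)[of t' s'] that head True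
      by (simp add: add.assoc add.commute add.left_commute)
    then show ?thesis
      using 1 test by (intro exI[of _ "words w (bits (rg r)) + t"] exI[of _ rg1] exI[of _ m1]) auto
  next
    case False
    obtain t rg1 m1 where 1: "t \<le> T" "small rg1 m1" "Q rg1 m1"
      "\<And>t' s'. runs w im P (cfg (l + 1 + csize c) rg1 m1) t' s' \<Longrightarrow>
        runs w im P (cfg (l + 1) rg m) (t + t') s'"
      using tripleE[OF assms(1)[OF False] small c] by metis
    have "runs w im P (cfg l rg m) (words w (bits (rg r)) + t + 1 + t') s'"
      if run: "runs w im P (cfg (l + csize (Cond r c d)) rg1 m1) t' s'" for t' s'
    proof -
      have "runs w im P (cfg (l + 1 + csize c) rg1 m1) (1 + t') s'"
        using runs_step[of P "l + 1 + csize c" rg1 m1 t' s'] run jump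
        by (simp add: add.assoc add.commute add.left_commute)
      from 1(4)[OF this] show ?thesis
        using runs_step[of P l rg m "t + (1 + t')" s'] head False
        by (simp add: add.assoc add.commute add.left_commute)
    qed
    then show ?thesis
      using 1 test unit_cost_ge_1
      by (intro exI[of _ "words w (bits (rg r)) + t + 1"] exI[of _ rg1] exI[of _ m1]) auto
  qed
qed

lemma triple_While_done:
  assumes "rg r = 0" "Q rg m"
  shows "triple (While r c) rg m unit_cost Q"
proof (rule tripleI)
  fix P l assume small: "small rg m" and code: "code_at P l (compile (While r c) l)"
  have head: "l < length P" "P ! l = JumpZero r (l + csize c + 2)"
    using code_at_Cons code unfolding compile.simps by blast+
  have "runs w im P (cfg l rg m) (words w (bits (rg r)) + t') s'"
    if "runs w im P (cfg (l + csize (While r c)) rg m) t' s'" for t' s'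
    using runs_step[of P l rg m t' s'] that head assms(1) by (simp add: add.assoc)
  moreover have "words w (bits (rg r)) \<le> unit_cost"
    using small by (intro words_le_unit_cost) (simp add: small_def)
  ultimately show "\<exists>t rg' m'. t \<le> unit_cost \<and> small rg' m' \<and> Q rg' m' \<and>
    (\<forall>t' s'. runs w im P (cfg (l + csize (While r c)) rg' m') t' s' \<longrightarrow> runs w im P (cfg l rg m) (t + t') s')"
    using small assms by blast
qed

text \<open>One unrolling: test, body and jump back. The rest of the loop enters as a premise, so
  that iterations may differ in cost and effect, as in the loop over all operations.\<close>

lemma triple_While_step:
  assumes "rg r \<noteq> 0" "triple c rg m T1 R"
    "\<And>rg' m'. R rg' m' \<Longrightarrow> triple (While r c) rg' m' T2 Q"
  shows "triple (While r c) rg m (T1 + T2 + 2 * unit_cost) Q"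
proof (rule tripleI)
  fix P l assume small: "small rg m" and code: "code_at P l (compile (While r c) l)"
  have head: "l < length P" "P ! l = JumpZero r (l + csize c + 2)"
    and tail: "code_at P (l + 1) (compile c (l + 1) @ [Jump l])"
    using code_at_Cons code unfolding compile.simps by blast+
  have c: "code_at P (l + 1) (compile c (l + 1))"
    and tail2: "code_at P (l + 1 + csize c) [Jump l]"
    using code_at_append[OF tail] by auto
  have jump: "l + 1 + csize c < length P" "P ! (l + 1 + csize c) = Jump l"
    using code_at_Cons[OF tail2] by auto
  have test: "words w (bits (rg r)) \<le> unit_cost"
    using small by (intro words_le_unit_cost) (simp add: small_def)
  obtain t1 rg1 m1 where 1: "t1 \<le> T1" "small rg1 m1" "R rg1 m1"
    "\<And>t' s'. runs w im P (cfg (l + 1 + csize c) rg1 m1) t' s' \<Longrightarrow>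
      runs w im P (cfg (l + 1) rg m) (t1 + t') s'"
    using tripleE[OF assms(2) small c] by metis
  obtain t2 rg2 m2 where 2: "t2 \<le> T2" "small rg2 m2" "Q rg2 m2"
    "\<And>t' s'. runs w im P (cfg (l + csize (While r c)) rg2 m2) t' s' \<Longrightarrow>
      runs w im P (cfg l rg1 m1) (t2 + t') s'"
    using tripleE[OF assms(3)[OF 1(3)] 1(2) code] by metis
  have "runs w im P (cfg l rg m) (words w (bits (rg r)) + t1 + 1 + t2 + t') s'"
    if run: "runs w im P (cfg (l + csize (While r c)) rg2 m2) t' s'" for t' s'
  proof -
    have "runs w im P (cfg (l + 1 + csize c) rg1 m1) (1 + (t2 + t')) s'"
      using runs_step[of P "l + 1 + csize c" rg1 m1 "t2 + t'" s'] 2(4)[OF run] jump by simp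
    from 1(4)[OF this] show ?thesis
      using runs_step[of P l rg m "t1 + (1 + (t2 + t'))" s'] head assms(1)
      by (simp add: add.assoc add.commute add.left_commute)
  qed
  then show "\<exists>t rg' m'. t \<le> T1 + T2 + 2 * unit_cost \<and> small rg' m' \<and> Q rg' m' \<and>
    (\<forall>t' s'. runs w im P (cfg (l + csize (While r c)) rg' m') t' s' \<longrightarrow> runs w im P (cfg l rg m) (t + t') s')"
    using 1 2 test unit_cost_ge_1
    by (intro exI[of _ "words w (bits (rg r)) + t1 + 1 + t2"] exI[of _ rg2] exI[of _ m2]) auto
qed

text \<open>The tested register equals the index of the invariant, so a body lowering the index by
  one runs exactly \<open>n\<close> times.\<close>

lemma triple_While_countdown:
  assumes "I n rg m"
    and test: "\<And>i rg m. I i rg m \<Longrightarrow> rg r = i"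
    and body: "\<And>i rg m. i < n \<Longrightarrow> I (Suc i) rg m \<Longrightarrow> triple c rg m T (I i)"
  shows "triple (While r c) rg m (n * (T + 2 * unit_cost) + unit_cost) (I 0)"
  using assms(1) body
proof (induction n arbitrary: rg m)
  case 0
  then show ?case using triple_While_done[of rg r "I 0" m c] test by simp
next
  case (Suc n)
  have "triple (While r c) rg m (T + (n * (T + 2 * unit_cost) + unit_cost) + 2 * unit_cost) (I 0)"
  proof (rule triple_While_step)
    show "rg r \<noteq> 0" using test[OF Suc.prems(1)] by simp
    show "triple c rg m T (I n)" using Suc.prems by simp
    show "triple (While r c) rg' m' (n * (T + 2 * unit_cost) + unit_cost) (I 0)" if "I n rg' m'" for rg' m'
      using Suc.IH[OF that] Suc.prems(2) by simp
  qed
  then show ?case by (simp add: algebra_simps)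
qed

lemma triple_Block':
  "wp is rg m Q \<Longrightarrow> (\<Sum>i\<leftarrow>is. instr_cost i) \<le> T \<Longrightarrow> triple (Block is) rg m T Q"
  using triple_Block triple_weaken by blast

lemma triple_Seq':
  assumes "triple c rg m T1 R" "\<And>rg' m'. R rg' m' \<Longrightarrow> triple d rg' m' T2 Q" "T1 + T2 \<le> T"
  shows "triple (c ;; d) rg m T Q"
  using triple_weaken[OF triple_Seq[OF assms(1,2)] assms(3)] by blast

lemma triple_Cond':
  assumes "rg r \<noteq> 0 \<Longrightarrow> triple c rg m T1 Q" "rg r = 0 \<Longrightarrow> triple d rg m T1 Q" "T1 + 2 * unit_cost \<le> T"
  shows "triple (Cond r c d) rg m T Q"
  using triple_weaken[OF triple_Cond[OF assms(1,2)] assms(3)] by blast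

end

section \<open>The program\<close>

text \<open>
  Registers 0 to 9 hold \<open>0\<close>, \<open>1\<close>, \<open>k\<close>, \<open>2 * k + 1\<close>, \<open>2 ^ (2 * k + 1)\<close>, the distance of consecutive
  tables on the stack, the size of a table, the address of the next operation, the number of
  remaining operations, and the address of the topmost table; 10 to 12 hold the current operation,
  13 the current index into a table, and the others are temporary. Tables are traversed
  downwards and updated in place.

  In \<open>vertex_cmd\<close>, truncated subtraction computes the indicators of \<open>\<kappa> = 0\<close> and \<open>\<kappa> = 1\<close>.
\<close>

definition vertex_cmd :: com where
  "vertex_cmd = Block [Op Add 9 9 5, Op Add 13 6 0, Op Add 15 2 11] ;;
     While 13 (Block [Op Sub 13 13 1, Op Shr 14 13 3, Op Sub 16 1 14, Op Shr 17 13 15, Op And 17 17 16,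
       Op Sub 14 14 1, Op Sub 14 1 14, Op Sub 14 14 16, Op Shr 18 13 11, Op And 18 18 14,
       Op Add 17 17 18, Op Add 14 9 13, Store 14 17])"

text \<open>The source index is assembled arithmetically: bit \<open>i\<close> of the index is
  removed and its bit \<open>j\<close> is added at position \<open>i\<close>, where \<open>i\<close>
  and \<open>j\<close> are the contents of registers 11 and 12.\<close>

definition copy_cmd :: com where
  "copy_cmd = Block [Op Add 13 6 0] ;;
     While 13 (Block [Op Sub 13 13 1, Op Shr 14 13 12, Op And 14 14 1, Op Shl 14 14 11,
       Op Shr 15 13 11, Op And 15 15 1, Op Shl 15 15 11, Op Sub 16 13 15, Op Add 16 16 14,
       Op Add 16 16 9, Load 16 16, Op Add 15 9 13, Store 15 16])"

text \<open>The update applies only if bit \<open>i\<close> is set and bit \<open>k + j\<close> is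
  clear, so clearing and setting them amounts to subtracting \<open>2 ^ i\<close> and adding
  \<open>2 ^ (k + j)\<close>. The \<open>And\<close> into register 14 also cuts the shifted index
  down to one bit.\<close>

definition arcs_cmd :: com where
  "arcs_cmd = Block [Op Add 13 6 0, Op Add 15 2 12, Op Shl 16 1 15, Op Shl 17 1 11] ;;
     While 13 (Block [Op Sub 13 13 1, Op Shr 14 13 11, Op Shr 18 13 15, Op And 18 18 1, Op Sub 18 1 18,
         Op And 14 14 18] ;;
       Cond 14
         (Block [Op Add 18 9 13, Op Sub 19 18 17, Load 14 19, Op Add 19 19 16, Load 20 19,
            Op Add 19 18 16, Load 19 19, Op Sub 19 19 20, Op Add 19 19 14, Store 18 19])
         (Block []))"

text \<open>Register 15 descends in the left table from size \<kappa> while register 16 ascends in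
  the right one from size 0, both in steps of \<open>M\<close> at fixed \<open>p\<close>. Register
  14 counts the remaining products, initially \<kappa> + 1.\<close>

definition union_cmd :: com where
  "union_cmd = Block [Op Sub 9 9 5, Op Add 13 6 0] ;;
     While 13 (Block [Op Sub 13 13 1, Op Shr 14 13 3, Op Add 14 14 1, Op Add 15 9 13, Op Sub 16 4 1,
         Op And 16 13 16, Op Add 16 16 9, Op Add 16 16 5, Const 17 0] ;;
       While 14 (Block [Op Sub 14 14 1, Load 18 15, Load 19 16, Op Mul 18 18 19, Op Add 17 17 18,
         Op Sub 15 15 4, Op Add 16 16 4]) ;;
       Block [Op Add 15 9 13, Store 15 17])"

definition relabel_cmd :: com where
  "relabel_cmd = copy_cmd ;; Block [Op Add 11 11 2, Op Add 12 12 2] ;; copy_cmd"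

definition join_cmd :: com where
  "join_cmd = arcs_cmd ;; Block [Op Add 14 11 0, Op Add 11 12 0, Op Add 12 14 0] ;; arcs_cmd"

definition op_cmd :: com where
  "op_cmd = Block [Op Sub 8 8 1, Load 10 7, Op Add 7 7 1, Load 11 7, Op Add 7 7 1, Load 12 7, Op Add 7 7 1] ;;
     Cond 10
       (Block [Op Sub 10 10 1] ;;
        Cond 10
          (Block [Op Sub 10 10 1] ;; Cond 10 union_cmd join_cmd)
          relabel_cmd)
       vertex_cmd"

text \<open>The number of vertices is not part of the input; it is found by summing the truncated
  differences \<open>1 - opcode\<close>. Register 5 becomes \<open>(3 * L + 2) * M\<close>, large
  enough for the \<open>3 * L + 2\<close> input cells as well as for a table. Register 9 keeps 0,
  which represents the empty stack.\<close>

definition init_cmd :: com where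
  "init_cmd = Block [Const 1 1, Load 2 0, Load 8 1, Op Add 3 2 2, Op Add 3 3 1, Op Shl 4 1 3,
       Op Add 5 8 8, Op Add 5 5 8, Op Add 5 5 1, Op Add 5 5 1, Op Shl 5 5 3,
       Const 7 2, Const 6 1, Op Add 13 8 0] ;;
     While 13 (Block [Op Sub 13 13 1, Load 10 7, Op Sub 14 1 10, Op Add 6 6 14, Const 14 3, Op Add 7 7 14]) ;;
     Block [Op Shl 6 6 3, Const 7 2]"

text \<open>One entry per block is read, at offset \<open>2 ^ (k + 1) - 1\<close>. The results
  overwrite the input from address 0 on, below the table.\<close>

definition output_cmd :: com where
  "output_cmd = Block [Op Add 14 2 1, Op Shl 14 1 14, Op Sub 14 14 1, Op Add 14 14 9, Op Shr 13 6 3] ;;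
     While 13 (Block [Op Sub 13 13 1, Op Shl 15 13 3, Op Add 15 15 14, Load 15 15, Store 13 15])"

definition main_cmd :: com where
  "main_cmd = init_cmd ;; While 8 op_cmd ;; output_cmd"

section \<open>Correctness and cost of the program\<close>

lemma unset_bit_eq_nat: "unset_bit n a = a - (if bit a n then 2 ^ n else 0)" for a :: nat
proof (cases "bit a n")
  case True
  then have "set_bit n (unset_bit n a) = a"
    by (intro bit_eqI) (auto simp: bit_set_bit_iff bit_unset_bit_iff)
  then have "unset_bit n a + 2 ^ n = a" by (simp add: set_bit_eq bit_unset_bit_iff)
  with True show ?thesis by simp
next
  case False
  then have "unset_bit n a = a" by (intro bit_eqI) (auto simp: bit_unset_bit_iff)
  with False show ?thesis by simp
qed

lemma bit_imp_le: "bit a n \<Longrightarrow> 2 ^ n \<le> a" for a :: nat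
  by (metis bit_iff_odd div_less even_zero not_le)

lemma copy_bit_eq: "copy_bit i j c = c - (if bit c i then 2 ^ i else 0) + (if bit c j then 2 ^ i else 0)"
  by (auto simp: copy_bit_def set_bit_eq unset_bit_eq_nat bit_imp_le)

lemma drop_bit_mod_two: "drop_bit a c mod 2 = of_bool (bit c a)" for c :: nat
  by (simp add: bit_iff_odd_drop_bit mod2_eq_if)

lemma length_postfix: "length (postfix e) = 3 * num_ops e"
  by (induction e) auto

lemma nth_postfix_last:
  "\<forall>n<length (xs @ [o', i, j]). m (ip + n) = (xs @ [o', i, j]) ! n \<Longrightarrow>
    m (ip + length xs) = o' \<and> m (ip + length xs + 1) = i \<and> m (ip + length xs + 2) = j"
  by (auto simp: nth_append dest: spec[of _ "length xs"] spec[of _ "length xs + 1"] spec[of _ "length xs + 2"])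

lemma sum_opcodes_append:
  fixes xs ys :: "nat list"
  assumes "length xs = 3 * a"
  shows "(\<Sum>n<a + b. 1 - (xs @ ys) ! (3 * n)) = (\<Sum>n<a. 1 - xs ! (3 * n)) + (\<Sum>n<b. 1 - ys ! (3 * n))"
proof -
  have "(\<Sum>n<a + b. 1 - (xs @ ys) ! (3 * n)) =
      (\<Sum>n<a. 1 - (xs @ ys) ! (3 * n)) + (\<Sum>n<b. 1 - (xs @ ys) ! (3 * (a + n)))"
    by (induction b) auto
  also have "\<dots> = (\<Sum>n<a. 1 - xs ! (3 * n)) + (\<Sum>n<b. 1 - ys ! (3 * n))"
    using assms by (auto simp: nth_append intro!: arg_cong2[where f = "(+)"] sum.cong)
  finally show ?thesis .
qed

text \<open>On opcodes the truncated \<open>1 - x\<close> is the indicator of 0, the opcode of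
  vertex creation.\<close>

lemma sum_opcodes: "(\<Sum>n<num_ops e. 1 - postfix e ! (3 * n)) = num_leaves e"
proof (induction e)
  case (Relabel i j e)
  then show ?case using sum_opcodes_append[of "postfix e" "num_ops e" "[1, i, j]" 1]
    by (simp add: length_postfix)
next
  case (Join i j e)
  then show ?case using sum_opcodes_append[of "postfix e" "num_ops e" "[2, i, j]" 1]
    by (simp add: length_postfix)
next
  case (Union e e')
  then show ?case
    using sum_opcodes_append[of "postfix e" "num_ops e" "postfix e' @ [3, 0, 0]" "num_ops e' + 1"]
      sum_opcodes_append[of "postfix e'" "num_ops e'" "[3, 0, 0]" 1]
    by (simp add: length_postfix add.assoc)
qed simp

text \<open>
  \<open>L\<close> is the number of operations, \<open>N\<close> the number of vertices. The stack has at most \<open>L\<close> tables and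
  starts at address \<open>stride\<close>, above the input.
\<close>

locale counting = machine +
  fixes k L :: nat
  assumes k: "k \<ge> 1" and L: "N + 1 \<le> 3 * L + 2"
    and space: "(L + 3) * ((3 * L + 2) * 2 ^ (2 * k + 1)) < 2 ^ B" and N: "N + 2 \<le> B"
begin

definition M :: nat where "M = 2 ^ (2 * k + 1)"
definition stride :: nat where "stride = (3 * L + 2) * M"
definition cells :: nat where "cells = (N + 1) * M"

definition ctx :: "nat \<Rightarrow> nat \<Rightarrow> nat \<Rightarrow> (nat \<Rightarrow> nat) \<Rightarrow> bool" where
  "ctx ip cnt b rg \<longleftrightarrow> rg 0 = 0 \<and> rg 1 = 1 \<and> rg 2 = k \<and> rg 3 = 2 * k + 1 \<and> rg 4 = M \<and>
     rg 5 = stride \<and> rg 6 = cells \<and> rg 7 = ip \<and> rg 8 = cnt \<and> rg 9 = b"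

text \<open>The memory midway through a downward in-place traversal with \<open>i\<close> entries
  still ahead; it serves as loop invariant of all table operations.\<close>

definition fill :: "nat \<Rightarrow> nat \<Rightarrow> (nat \<Rightarrow> nat) \<Rightarrow> (nat \<Rightarrow> nat) \<Rightarrow> nat \<Rightarrow> nat" where
  "fill b i f m = (\<lambda>a. if b + i \<le> a \<and> a < b + cells then f (a - b) else m a)"

lemma fill_cells: "fill b cells f m = m"
  by (auto simp: fill_def)

lemma fill_update: "i < cells \<Longrightarrow> (fill b (Suc i) f m)(b + i := f i) = fill b i f m"
  by (auto simp: fill_def fun_eq_iff)

lemma fill_skip: "f i = m (b + i) \<Longrightarrow> fill b (Suc i) f m = fill b i f m"
  by (rule ext) (auto simp: fill_def Suc_le_eq le_less)

lemma fill_read: "fill b i f m (b + c) = (if i \<le> c \<and> c < cells then f c else m (b + c))"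
  by (simp add: fill_def)

lemma M_pos: "M > 0" and M_ge: "M \<ge> 2 * k + 2" and pow_less_M: "a \<le> 2 * k \<Longrightarrow> 2 ^ a < M"
  and M_le_cells: "M \<le> cells" and cells_le: "cells \<le> stride"
  and stride_less: "3 * stride < 2 ^ B" and count_less: "2 ^ (N + 2) \<le> (2::nat) ^ B"
proof -
  show "M > 0" by (simp add: M_def)
  have "n + 1 \<le> 2 ^ n" for n :: nat by (induction n) auto
  from this[of "2 * k + 1"] show "M \<ge> 2 * k + 2" by (simp add: M_def)
  show "2 ^ a < M" if "a \<le> 2 * k" unfolding M_def using that by (intro power_strict_increasing) auto
  show "M \<le> cells" by (simp add: cells_def)
  show "cells \<le> stride" unfolding cells_def stride_def using L by (intro mult_le_mono1)
  have "3 * stride \<le> (L + 3) * stride" by simp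
  then show "3 * stride < 2 ^ B" using space by (simp add: stride_def M_def)
  show "2 ^ (N + 2) \<le> (2::nat) ^ B" using N by (intro power_increasing) auto
qed

lemma cells_pos: "cells \<ge> 1"
  using M_pos M_le_cells by simp

lemma less_cells_iff: "c < cells \<longleftrightarrow> c div M \<le> N"
  using M_pos by (simp add: cells_def div_less_iff_less_mult flip: less_Suc_eq_le)

lemma copy_bit_less: "i \<le> 2 * k \<Longrightarrow> c < cells \<Longrightarrow> copy_bit i j c < cells"
proof -
  assume "i \<le> 2 * k" "c < cells"
  then have "copy_bit i j c div M = c div M" unfolding M_def
    by (intro div_eqI_bits) (auto simp: bit_copy_bit)
  with \<open>c < cells\<close> show ?thesis by (simp add: less_cells_iff)
qed

lemma set_bit_less: "i \<le> 2 * k \<Longrightarrow> c < cells \<Longrightarrow> set_bit i c < cells"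
proof -
  assume "i \<le> 2 * k" "c < cells"
  then have "set_bit i c div M = c div M" unfolding M_def
    by (intro div_eqI_bits) (auto simp: bit_set_bit_iff)
  with \<open>c < cells\<close> show ?thesis by (simp add: less_cells_iff)
qed

lemma unset_bit_le: "unset_bit i c \<le> (c :: nat)"
  by (simp add: unset_bit_eq_nat)

section \<open>Single operations on tables in memory\<close>

lemma triple_vertex:
  assumes "ctx ip cnt b rg" "rg 11 = i" "i \<in> {1..k}" "b + 2 * stride < 2 ^ B"
  shows "triple vertex_cmd rg m (20 * cells * unit_cost)
    (\<lambda>rg' m'. ctx ip cnt (b + stride) rg' \<and> m' = fill (b + stride) 0 (entry k (Vertex i)) m)"
proof -
  let ?f = "entry k (Vertex i)"
  let ?I = "\<lambda>c rg' m'. ctx ip cnt (b + stride) rg' \<and> rg' 11 = i \<and> rg' 15 = k + i \<and> rg' 13 = c \<and>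
    m' = fill (b + stride) c ?f m"
  note facts = M_ge M_le_cells cells_le stride_less
  \<comment> \<open>Simplified form of the computed value. With \<kappa> the shifted index,
    \<open>1 - \<kappa>\<close> indicates \<kappa> = 0 and
    \<open>1 - (\<kappa> - 1) - (1 - \<kappa>)\<close> indicates \<kappa> = 1; combining with an
    indicator by \<open>and\<close> keeps at most the lowest bit of the other operand.\<close>
  have val: "and (drop_bit (k + i) c) (Suc 0 - drop_bit (Suc (2 * k)) c) +
      and (drop_bit i c) (Suc 0 - (drop_bit (Suc (2 * k)) c - Suc 0 + (Suc 0 - drop_bit (Suc (2 * k)) c))) = ?f c" for c
  proof -
    consider "drop_bit (2 * k + 1) c = 0" | "drop_bit (2 * k + 1) c = 1" | "drop_bit (2 * k + 1) c > 1"
      by linarith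
    then show ?thesis
      unfolding entry_def drop_bit_eq_div[symmetric] expr_count_Vertex
      by cases (simp_all add: drop_bit_mod_two)
  qed
  have le1: "?f c \<le> 1" for c by (simp add: entry_def expr_count_Vertex)
  show ?thesis
    unfolding vertex_cmd_def
  proof (rule triple_Seq')
    show "triple (Block [Op Add 9 9 5, Op Add 13 6 0, Op Add 15 2 11]) rg m (3 * unit_cost) (?I cells)"
      by (rule triple_Block') (use assms facts in \<open>auto simp: ctx_def fill_cells\<close>)
    show "triple (While 13 (Block [Op Sub 13 13 1, Op Shr 14 13 3, Op Sub 16 1 14, Op Shr 17 13 15, Op And 17 17 16,
       Op Sub 14 14 1, Op Sub 14 1 14, Op Sub 14 14 16, Op Shr 18 13 11, Op And 18 18 14,
       Op Add 17 17 18, Op Add 14 9 13, Store 14 17])) rg' m' (cells * (13 * unit_cost + 2 * unit_cost) + unit_cost)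
      (\<lambda>rg' m'. ctx ip cnt (b + stride) rg' \<and> m' = fill (b + stride) 0 ?f m)"
      if "?I cells rg' m'" for rg' m'
    proof (rule triple_weaken[OF triple_While_countdown[where I = ?I]], fact that)
      show "rg 13 = c" if "?I c rg m" for c rg m using that by simp
      show "triple (Block [Op Sub 13 13 1, Op Shr 14 13 3, Op Sub 16 1 14, Op Shr 17 13 15, Op And 17 17 16,
       Op Sub 14 14 1, Op Sub 14 1 14, Op Sub 14 14 16, Op Shr 18 13 11, Op And 18 18 14,
       Op Add 17 17 18, Op Add 14 9 13, Store 14 17]) rg m (13 * unit_cost) (?I c)"
        if "c < cells" "?I (Suc c) rg m" for c rg m
        using that le1[of c] assms(3,4) facts
        by (intro triple_Block') (simp_all add: ctx_def val fill_update)
    qed auto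
    show "3 * unit_cost + (cells * (13 * unit_cost + 2 * unit_cost) + unit_cost) \<le> 20 * cells * unit_cost"
      using cells_pos by (simp add: algebra_simps)
  qed
qed

text \<open>
  In-place updating is sound because the entries at indices \<^term>\<open>copy_bit i j c\<close> never change. The
  same holds below for the entries read by \<open>arcs_cmd\<close>.
\<close>

lemma triple_copy:
  assumes "ctx ip cnt b rg" "rg 11 = i" "rg 12 = j" "i \<le> 2 * k" "j \<le> 2 * k" "b + 2 * stride < 2 ^ B"
  shows "triple copy_cmd rg m (20 * cells * unit_cost)
    (\<lambda>rg' m'. ctx ip cnt b rg' \<and> rg' 11 = i \<and> rg' 12 = j \<and> m' = fill b 0 (\<lambda>c. m (b + copy_bit i j c)) m)"
proof -
  let ?f = "\<lambda>c. m (b + copy_bit i j c)"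
  let ?I = "\<lambda>c rg' m'. ctx ip cnt b rg' \<and> rg' 11 = i \<and> rg' 12 = j \<and> rg' 13 = c \<and> m' = fill b c ?f m"
  note facts = M_ge M_le_cells cells_le stride_less
  have idem: "copy_bit i j (copy_bit i j c) = copy_bit i j c" for c
    by (rule bit_eqI) (auto simp: bit_copy_bit)
  have read: "fill b (Suc c) ?f m (b + copy_bit i j c) = ?f c" for c
    by (auto simp: fill_read idem)
  have upd: "c < cells \<Longrightarrow> (fill b (Suc c) ?f m)(b + c := ?f c) = fill b c ?f m" for c
    by (rule fill_update)
  have adr: "c - push_bit i (of_bool (bit c i)) + push_bit i (of_bool (bit c j)) = copy_bit i j c" for c
    by (auto simp: copy_bit_eq)
  have shift: "push_bit i (of_bool P) < (2::nat) ^ B" for P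
  proof -
    have "(2::nat) ^ i < 2 ^ B" using pow_less_M[OF assms(4)] facts by linarith
    then show ?thesis by (cases P) simp_all
  qed
  show ?thesis
    unfolding copy_cmd_def
  proof (rule triple_Seq')
    show "triple (Block [Op Add 13 6 0]) rg m unit_cost (?I cells)"
      by (rule triple_Block') (use assms facts in \<open>auto simp: ctx_def fill_cells\<close>)
    show "triple (While 13 (Block [Op Sub 13 13 1, Op Shr 14 13 12, Op And 14 14 1, Op Shl 14 14 11,
       Op Shr 15 13 11, Op And 15 15 1, Op Shl 15 15 11, Op Sub 16 13 15, Op Add 16 16 14,
       Op Add 16 16 9, Load 16 16, Op Add 15 9 13, Store 15 16])) rg' m' (cells * (13 * unit_cost + 2 * unit_cost) + unit_cost)
      (\<lambda>rg' m'. ctx ip cnt b rg' \<and> rg' 11 = i \<and> rg' 12 = j \<and> m' = fill b 0 ?f m)"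
      if "?I cells rg' m'" for rg' m'
    proof (rule triple_weaken[OF triple_While_countdown[where I = ?I]], fact that)
      show "rg 13 = c" if "?I c rg m'" for c rg m' using that by simp
      show "triple (Block [Op Sub 13 13 1, Op Shr 14 13 12, Op And 14 14 1, Op Shl 14 14 11,
       Op Shr 15 13 11, Op And 15 15 1, Op Shl 15 15 11, Op Sub 16 13 15, Op Add 16 16 14,
       Op Add 16 16 9, Load 16 16, Op Add 15 9 13, Store 15 16]) rg m' (13 * unit_cost) (?I c)"
        if "c < cells" "?I (Suc c) rg m'" for c rg m'
        using that read[of c] copy_bit_less[OF assms(4) that(1), of j] assms(4,5,6) facts
        by (intro triple_Block')
          (simp_all add: ctx_def drop_bit_mod_two adr shift upd add.commute[of _ b])
    qed auto
    show "unit_cost + (cells * (13 * unit_cost + 2 * unit_cost) + unit_cost) \<le> 20 * cells * unit_cost"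
      using cells_pos by (simp add: algebra_simps)
  qed
qed

lemma triple_arcs:
  assumes "ctx ip cnt b rg" "rg 11 = i" "rg 12 = j" "i \<in> {1..k}" "j \<in> {1..k}" "b + 2 * stride < 2 ^ B"
    and small: "\<And>c. c < cells \<Longrightarrow> 2 * m (b + c) < 2 ^ B"
  shows "triple arcs_cmd rg m (30 * cells * unit_cost)
    (\<lambda>rg' m'. ctx ip cnt b rg' \<and> rg' 11 = i \<and> rg' 12 = j \<and>
       m' = fill b 0 (arcs_update i (k + j) (\<lambda>c. m (b + c))) m)"
proof -
  let ?t = "\<lambda>c. m (b + c)" and ?y = "k + j"
  let ?f = "arcs_update i ?y ?t"
  let ?I = "\<lambda>c rg' m'. ctx ip cnt b rg' \<and> rg' 11 = i \<and> rg' 12 = j \<and> rg' 15 = ?y \<and> rg' 16 = 2 ^ ?y \<and>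
    rg' 17 = 2 ^ i \<and> rg' 13 = c \<and> m' = fill b c ?f m"
  note facts = M_ge M_le_cells cells_le stride_less
  have iy: "i \<le> 2 * k" "?y \<le> 2 * k" "i \<noteq> ?y" using assms(4,5) by auto
  have pow: "(2::nat) ^ i < M" "(2::nat) ^ ?y < M" using pow_less_M iy by blast+
  then have pow_B: "push_bit i (Suc 0) < 2 ^ B" "push_bit ?y (Suc 0) < 2 ^ B"
    using facts by (simp_all only: push_bit_of_Suc_0)
  have flag: "and (of_bool (bit c i)) (Suc 0 - of_bool (bit c ?y)) = (of_bool (bit c i \<and> \<not> bit c ?y) :: nat)" for c :: nat
    by (cases "bit c i"; cases "bit c ?y") simp_all
  show ?thesis
    unfolding arcs_cmd_def
  proof (rule triple_Seq')
    show "triple (Block [Op Add 13 6 0, Op Add 15 2 12, Op Shl 16 1 15, Op Shl 17 1 11]) rg m (4 * unit_cost) (?I cells)"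
      by (rule triple_Block') (use assms(1-6) facts pow_B in \<open>simp_all add: ctx_def fill_cells push_bit_of_Suc_0\<close>)
    show "triple (While 13 (Block [Op Sub 13 13 1, Op Shr 14 13 11, Op Shr 18 13 15, Op And 18 18 1, Op Sub 18 1 18,
         Op And 14 14 18] ;;
       Cond 14
         (Block [Op Add 18 9 13, Op Sub 19 18 17, Load 14 19, Op Add 19 19 16, Load 20 19,
            Op Add 19 18 16, Load 19 19, Op Sub 19 19 20, Op Add 19 19 14, Store 18 19])
         (Block []))) rg' m' (cells * (18 * unit_cost + 2 * unit_cost) + unit_cost)
      (\<lambda>rg' m'. ctx ip cnt b rg' \<and> rg' 11 = i \<and> rg' 12 = j \<and> m' = fill b 0 ?f m)"
      if "?I cells rg' m'" for rg' m'
    proof (rule triple_weaken[OF triple_While_countdown[where I = ?I]], fact that)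
      show "rg 13 = c" if "?I c rg m'" for c rg m' using that by simp
      show "triple (Block [Op Sub 13 13 1, Op Shr 14 13 11, Op Shr 18 13 15, Op And 18 18 1, Op Sub 18 1 18,
         Op And 14 14 18] ;;
       Cond 14
         (Block [Op Add 18 9 13, Op Sub 19 18 17, Load 14 19, Op Add 19 19 16, Load 20 19,
            Op Add 19 18 16, Load 19 19, Op Sub 19 19 20, Op Add 19 19 14, Store 18 19])
         (Block [])) rg m' (18 * unit_cost) (?I c)"
        if c: "c < cells" and I: "?I (Suc c) rg m'" for c rg m'
      proof (rule triple_Seq')
        \<comment> \<open>\<open>?I c\<close> is given the memory that it asks for, so here it
          constrains only registers; the actual memory is still \<open>m'\<close>, where entry
          \<open>c\<close> is old.\<close>
        let ?J = "\<lambda>rg' m''. ?I c (rg'(13 := c)) (fill b c ?f m) \<and> rg' 13 = c \<and> m'' = m' \<and>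
          rg' 14 = of_bool (bit c i \<and> \<not> bit c ?y)"
        show "triple (Block [Op Sub 13 13 1, Op Shr 14 13 11, Op Shr 18 13 15, Op And 18 18 1, Op Sub 18 1 18,
         Op And 14 14 18]) rg m' (6 * unit_cost) ?J"
          by (rule triple_Block') (use I in \<open>simp_all add: ctx_def drop_bit_mod_two flag\<close>)
        show "triple (Cond 14
         (Block [Op Add 18 9 13, Op Sub 19 18 17, Load 14 19, Op Add 19 19 16, Load 20 19,
            Op Add 19 18 16, Load 19 19, Op Sub 19 19 20, Op Add 19 19 14, Store 18 19])
         (Block [])) rg' m'' (12 * unit_cost) (?I c)"
          if J: "?J rg' m''" for rg' m''
        proof (rule triple_Cond')
          assume "rg' 14 \<noteq> 0"
          with J have bits: "bit c i" "\<not> bit c ?y" by (simp_all split: if_splits)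
          define u where "u = unset_bit i c"
          have u: "u + 2 ^ i = c" and "u \<le> c"
            using bit_imp_le[OF bits(1)] bits by (simp_all add: u_def unset_bit_eq_nat)
          have [simp]: "bit u i = False" "bit u ?y = False"
            using bits by (simp_all add: u_def bit_unset_bit_iff)
          have sets: "set_bit ?y c = c + 2 ^ ?y" "set_bit ?y u = u + 2 ^ ?y"
            using bits by (simp_all add: set_bit_eq)
          have less: "c + 2 ^ ?y < cells" "u + 2 ^ ?y < cells" "u < cells"
            using set_bit_less[OF iy(2) c] \<open>u \<le> c\<close> c unfolding sets by simp_all
          \<comment> \<open>All three sources fail the test of \<open>arcs_update\<close>, having
            bit \<open>i\<close> clear or bit \<open>k + j\<close> set. The update fixes them, so it
            does not matter which of them have been passed already.\<close>
          have "\<not> bit u i" "bit (c + 2 ^ ?y) ?y" "\<not> bit (u + 2 ^ ?y) i"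
            using bits iy unfolding sets[symmetric] by (simp_all add: bit_set_bit_iff)
          then have "?f u = ?t u" "?f (c + 2 ^ ?y) = ?t (c + 2 ^ ?y)" "?f (u + 2 ^ ?y) = ?t (u + 2 ^ ?y)"
            by (simp_all add: arcs_update_def)
          then have read: "fill b (Suc c) ?f m (b + u) = ?t u"
            "fill b (Suc c) ?f m (b + (c + 2 ^ ?y)) = ?t (c + 2 ^ ?y)"
            "fill b (Suc c) ?f m (b + (u + 2 ^ ?y)) = ?t (u + 2 ^ ?y)"
            unfolding fill_read by simp_all
          have val: "?t (c + 2 ^ ?y) - ?t (u + 2 ^ ?y) + ?t u = ?f c"
            using bits sets by (simp add: arcs_update_def u_def)
          \<comment> \<open>Subtracting first leaves at most the sum of two entries, which is why
            \<open>small\<close> carries the factor 2.\<close>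
          have "?t (c + 2 ^ ?y) - ?t (u + 2 ^ ?y) + ?t u < 2 ^ B"
            using small[OF less(1)] small[OF less(3)] by linarith
          moreover have "b + c - 2 ^ i = b + u" using u by linarith
          moreover have "b + cells < 2 ^ B" "cells < 2 ^ B" using facts assms(6) by linarith+
          ultimately show "triple (Block [Op Add 18 9 13, Op Sub 19 18 17, Load 14 19, Op Add 19 19 16, Load 20 19,
            Op Add 19 18 16, Load 19 19, Op Sub 19 19 20, Op Add 19 19 14, Store 18 19]) rg' m'' (10 * unit_cost) (?I c)"
            using J I c less read val fill_update[OF c, of b ?f m]
            by (intro triple_Block') (simp_all add: ctx_def add.assoc)
        next
          assume "rg' 14 = 0"
          with J have "?f c = ?t c" by (auto simp: arcs_update_def split: if_splits)
          from fill_skip[of ?f c m b, OF this] show "triple (Block []) rg' m'' (10 * unit_cost) (?I c)"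
            using J I by (intro triple_Block') (simp_all add: ctx_def)
        qed simp
      qed simp
    qed auto
    show "4 * unit_cost + (cells * (18 * unit_cost + 2 * unit_cost) + unit_cost) \<le> 30 * cells * unit_cost"
      using cells_pos by (simp add: algebra_simps)
  qed
qed

definition convolution :: "(nat \<Rightarrow> nat) \<Rightarrow> (nat \<Rightarrow> nat) \<Rightarrow> nat \<Rightarrow> nat" where
  "convolution f g c =
    (\<Sum>a\<le>c div M. f (a * M + c mod M) * g ((c div M - a) * M + c mod M))"

lemma drop_bit_eq_div_M: "drop_bit (Suc (2 * k)) c = c div M"
  by (simp add: M_def drop_bit_eq_div)

lemma and_M_minus_1: "and c (M - Suc 0) = c mod M"
  using take_bit_eq_mask[of "2 * k + 1" c] by (simp add: M_def take_bit_eq_mod mask_eq_exp_minus_1)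

text \<open>Entry \<open>c\<close> depends on left entries at indices at most \<open>c\<close>,
  which a downward traversal has not yet overwritten, and on the right table, which lies beyond the
  cells being written. So the result can replace the left operand.\<close>

lemma triple_union:
  assumes ctx: "ctx ip cnt (b + stride) rg" and b: "stride \<le> b" "b + 3 * stride < 2 ^ B"
    and left: "\<And>c. c < cells \<Longrightarrow> m (b + c) < 2 ^ N"
    and right: "\<And>c. c < cells \<Longrightarrow> m (b + stride + c) < 2 ^ N"
    and conv: "\<And>c. c < cells \<Longrightarrow> convolution (\<lambda>c. m (b + c)) (\<lambda>c. m (b + stride + c)) c < 2 ^ N"
  shows "triple union_cmd rg m (30 * cells * (N + 1) * (unit_cost + mul_cost))
    (\<lambda>rg' m'. ctx ip cnt b rg' \<and>
       m' = fill b 0 (convolution (\<lambda>c. m (b + c)) (\<lambda>c. m (b + stride + c))) m)"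
proof -
  let ?f = "convolution (\<lambda>c. m (b + c)) (\<lambda>c. m (b + stride + c))"
  let ?I = "\<lambda>c rg' m'. ctx ip cnt b rg' \<and> rg' 13 = c \<and> m' = fill b c ?f m"
  note facts = M_ge M_pos M_le_cells cells_le stride_less
  have N_B: "x < 2 ^ B" if "x < 2 ^ N" for x :: nat
    using that count_less by simp
  show ?thesis
    unfolding union_cmd_def
  proof (rule triple_Seq')
    show "triple (Block [Op Sub 9 9 5, Op Add 13 6 0]) rg m (2 * unit_cost) (?I cells)"
      by (rule triple_Block') (use ctx facts in \<open>simp_all add: ctx_def fill_cells\<close>)
    let ?inner_body = "Block [Op Sub 14 14 1, Load 18 15, Load 19 16, Op Mul 18 18 19, Op Add 17 17 18,
         Op Sub 15 15 4, Op Add 16 16 4]"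
    let ?K = "(N + 1) * (6 * unit_cost + mul_cost + 2 * unit_cost) + unit_cost"
    show "triple (While 13 (Block [Op Sub 13 13 1, Op Shr 14 13 3, Op Add 14 14 1, Op Add 15 9 13, Op Sub 16 4 1,
         Op And 16 13 16, Op Add 16 16 9, Op Add 16 16 5, Const 17 0] ;;
       While 14 ?inner_body ;; Block [Op Add 15 9 13, Store 15 17])) rg' m'
      (cells * (9 * unit_cost + (?K + 2 * unit_cost) + 2 * unit_cost) + unit_cost)
      (\<lambda>rg' m'. ctx ip cnt b rg' \<and> m' = fill b 0 ?f m)"
      if "?I cells rg' m'" for rg' m'
    proof (rule triple_weaken[OF triple_While_countdown[where I = ?I]], fact that)
      show "rg 13 = c" if "?I c rg m'" for c rg m' using that by simp
      show "triple (Block [Op Sub 13 13 1, Op Shr 14 13 3, Op Add 14 14 1, Op Add 15 9 13, Op Sub 16 4 1,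
         Op And 16 13 16, Op Add 16 16 9, Op Add 16 16 5, Const 17 0] ;;
       While 14 ?inner_body ;; Block [Op Add 15 9 13, Store 15 17]) rg m' (9 * unit_cost + (?K + 2 * unit_cost)) (?I c)"
        if c: "c < cells" and I: "?I (Suc c) rg m'" for c rg m'
      proof -
        define \<kappa> p where "\<kappa> = c div M" and "p = c mod M"
        define g where "g a = m (b + (a * M + p)) * m (b + stride + ((\<kappa> - a) * M + p))" for a
        have c_eq: "c = \<kappa> * M + p" by (simp add: \<kappa>_def p_def)
        have p: "p < M" and \<kappa>: "\<kappa> \<le> N"
          using M_pos c by (simp_all add: p_def \<kappa>_def less_cells_iff)
        have f: "?f c = sum g {0..\<kappa>}"
          by (simp add: convolution_def g_def \<kappa>_def p_def atMost_atLeast0)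
        have index: "a * M + p < cells" if "a \<le> \<kappa>" for a
          using that \<kappa> p by (simp add: less_cells_iff)
        \<comment> \<open>Partial sums, and hence single products, are bounded by the full
          convolution; this keeps the accumulator and the products within \<open>B\<close>
          bits.\<close>
        have part: "sum g {a..\<kappa>} < 2 ^ N" for a
        proof -
          have "sum g {a..\<kappa>} \<le> sum g {0..\<kappa>}" by (rule sum_mono2) auto
          also have "\<dots> < 2 ^ N" using conv[OF c] f by simp
          finally show ?thesis .
        qed
        \<comment> \<open>\<open>q\<close> products remain, the next one with
          \<open>a = q - 1\<close>. The subtraction of \<open>M\<close> stands outside, so that the
          expression also covers \<open>q = 0\<close>, where the pointer is no longer read.\<close>
        let ?J = "\<lambda>q rg' m''. ctx ip cnt b rg' \<and> rg' 13 = c \<and> m'' = m' \<and> rg' 14 = q \<and> q \<le> \<kappa> + 1 \<and>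
          rg' 15 = b + (q * M + p) - M \<and> rg' 16 = b + stride + ((\<kappa> + 1 - q) * M + p) \<and> rg' 17 = sum g {q..\<kappa>}"
        show ?thesis
        proof (rule triple_Seq')
          have "\<kappa> < 2 ^ N" using \<kappa> by (metis less_exp order_le_less_trans)
          then have "Suc \<kappa> < 2 ^ B" using count_less by simp
          moreover have "b + c < 2 ^ B" using c facts b by linarith
          moreover have "p + b + stride < 2 ^ B" "p + b < 2 ^ B" using p facts b by linarith+
          moreover have "b + (Suc \<kappa> * M + p) - M = b + c" by (simp add: c_eq)
          ultimately show "triple (Block [Op Sub 13 13 1, Op Shr 14 13 3, Op Add 14 14 1, Op Add 15 9 13, Op Sub 16 4 1,
             Op And 16 13 16, Op Add 16 16 9, Op Add 16 16 5, Const 17 0]) rg m' (9 * unit_cost) (?J (\<kappa> + 1))"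
            using I
            by (intro triple_Block')
              (simp_all add: ctx_def drop_bit_eq_div_M and_M_minus_1 flip: \<kappa>_def p_def)
          show "triple (While 14 ?inner_body ;; Block [Op Add 15 9 13, Store 15 17]) rg1 m1 (?K + 2 * unit_cost) (?I c)"
            if J: "?J (\<kappa> + 1) rg1 m1" for rg1 m1
          proof (rule triple_Seq')
            show "triple (While 14 ?inner_body) rg1 m1 ?K (?J 0)"
            proof (rule triple_weaken[OF triple_While_countdown[where I = ?J and n = "\<kappa> + 1"]], fact J)
              show "rg 14 = q" if "?J q rg m'" for q rg m' using that by simp
              show "triple ?inner_body rg2 m2 (6 * unit_cost + mul_cost) (?J q)"
                if q: "q < \<kappa> + 1" and J: "?J (Suc q) rg2 m2" for q rg2 m2
              proof (rule triple_Block')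
                have "q \<le> \<kappa>" using q by simp
                have "fill b (Suc c) ?f m (b + (q * M + p)) = m (b + (q * M + p))"
                proof -
                  have "q * M + p < Suc c" using \<open>q \<le> \<kappa>\<close> by (simp add: c_eq less_Suc_eq_le)
                  then show ?thesis by (simp add: fill_read del: less_Suc_eq_le)
                qed
                moreover have "fill b (Suc c) ?f m (b + stride + x) = m (b + stride + x)" for x
                  using facts by (simp add: fill_def)
                moreover have "b + (Suc q * M + p) - M = b + (q * M + p)" by simp
                moreover have "sum g {q..\<kappa>} = sum g {Suc q..\<kappa>} + g q"
                  using \<open>q \<le> \<kappa>\<close> by (simp add: sum.atLeast_Suc_atMost)
                moreover have "m (b + (q * M + p)) < 2 ^ N" "m (b + stride + ((\<kappa> - q) * M + p)) < 2 ^ N"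
                  using left right index \<open>q \<le> \<kappa>\<close> by simp_all
                moreover have "b + stride + ((\<kappa> - q) * M + p) + M = b + stride + ((\<kappa> + 1 - q) * M + p)"
                  using \<open>q \<le> \<kappa>\<close> by (simp add: Suc_diff_le)
                moreover have "b + stride + ((\<kappa> - q) * M + p) + M < 2 ^ B"
                  using index[of "\<kappa> - q"] facts b by linarith
                moreover have "sum g {q..\<kappa>} < 2 ^ B" using N_B part by blast
                moreover have "g q < 2 ^ B" using calculation(4,9) by linarith
                ultimately show "wp [Op Sub 14 14 1, Load 18 15, Load 19 16, Op Mul 18 18 19, Op Add 17 17 18,
                    Op Sub 15 15 4, Op Add 16 16 4] rg2 m2 (?J q)"
                  using J I \<open>q \<le> \<kappa>\<close> by (simp add: ctx_def g_def)
              qed simp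
              show "(\<kappa> + 1) * (6 * unit_cost + mul_cost + 2 * unit_cost) + unit_cost \<le> ?K"
                using \<kappa> by (intro add_mono mult_le_mono) auto
            qed
            show "triple (Block [Op Add 15 9 13, Store 15 17]) rg2 m2 (2 * unit_cost) (?I c)"
              if "?J 0 rg2 m2" for rg2 m2
            proof -
              have "b + c < 2 ^ B" using c facts b by linarith
              then show ?thesis
                using that I f fill_update[OF c, of b ?f m] by (intro triple_Block') (simp_all add: ctx_def)
            qed
          qed simp
        qed simp
      qed
    qed auto
    have "cells * (9 * unit_cost + (?K + 2 * unit_cost) + 2 * unit_cost) + 3 * unit_cost
        \<le> cells * ((N + 1) * (25 * unit_cost + mul_cost)) + cells * ((N + 1) * (5 * unit_cost))"
    proof (rule add_mono)
      show "cells * (9 * unit_cost + (?K + 2 * unit_cost) + 2 * unit_cost) \<le> cells * ((N + 1) * (25 * unit_cost + mul_cost))"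
        by (intro mult_le_mono2) (simp add: algebra_simps)
      have "1 * (1 * (5 * unit_cost)) \<le> cells * ((N + 1) * (5 * unit_cost))"
        using cells_pos by (intro mult_le_mono) auto
      then show "3 * unit_cost \<le> cells * ((N + 1) * (5 * unit_cost))" by simp
    qed
    also have "\<dots> \<le> 30 * cells * (N + 1) * (unit_cost + mul_cost)" by (simp add: algebra_simps)
    finally show "2 * unit_cost + (cells * (9 * unit_cost + (?K + 2 * unit_cost) + 2 * unit_cost) + unit_cost) \<le>
      30 * cells * (N + 1) * (unit_cost + mul_cost)" by simp
  qed
qed

section \<open>Tables of an expression under each operation\<close>

definition table :: "nat \<Rightarrow> kexp \<Rightarrow> (nat \<Rightarrow> nat) \<Rightarrow> bool" where
  "table b e m \<longleftrightarrow> (\<forall>c<cells. m (b + c) = entry k e c)"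

lemma entry_less: "num_leaves e \<le> N \<Longrightarrow> entry k e c < 2 ^ N"
  unfolding entry_def
  by (rule less_le_trans[OF expr_count_less]) (simp add: power_increasing)

lemma table_less: "table b e m \<Longrightarrow> num_leaves e \<le> N \<Longrightarrow> c < cells \<Longrightarrow> m (b + c) < 2 ^ N"
  by (simp add: table_def entry_less)

lemma same_block_less: "q div 2 ^ (2 * k + 1) = c div 2 ^ (2 * k + 1) \<Longrightarrow> c < cells \<Longrightarrow> q < cells"
  by (simp add: less_cells_iff M_def)

lemma fill_below: "a < b \<Longrightarrow> fill b 0 f m a = m a"
  by (simp add: fill_def)

lemma triple_relabel:
  assumes ctx: "ctx ip cnt b rg" "rg 11 = i" "rg 12 = j" and b: "b + 2 * stride < 2 ^ B"
    and e: "k_expression k (Relabel i j e)" and tab: "table b e m"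
  shows "triple relabel_cmd rg m (45 * cells * unit_cost)
    (\<lambda>rg' m'. ctx ip cnt b rg' \<and> table b (Relabel i j e) m' \<and> (\<forall>a<b. m' a = m a))"
  unfolding relabel_cmd_def
proof (rule triple_Seq')
  let ?m1 = "fill b 0 (\<lambda>c. m (b + copy_bit i j c)) m"
  let ?m2 = "fill b 0 (\<lambda>c. ?m1 (b + copy_bit (k + i) (k + j) c)) ?m1"
  have ij: "1 \<le> i" "i \<le> k" "1 \<le> j" "j \<le> k" using e by auto
  show "triple copy_cmd rg m (20 * cells * unit_cost)
      (\<lambda>rg' m'. ctx ip cnt b rg' \<and> rg' 11 = i \<and> rg' 12 = j \<and> m' = ?m1)"
    using ij b ctx by (intro triple_copy) auto
  show "triple (Block [Op Add 11 11 2, Op Add 12 12 2] ;; copy_cmd) rg1 m1 (2 * unit_cost + 20 * cells * unit_cost)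
      (\<lambda>rg' m'. ctx ip cnt b rg' \<and> table b (Relabel i j e) m' \<and> (\<forall>a<b. m' a = m a))"
    if 1: "ctx ip cnt b rg1 \<and> rg1 11 = i \<and> rg1 12 = j \<and> m1 = ?m1" for rg1 m1
  proof (rule triple_Seq')
    have "i + k < 2 ^ B" "j + k < 2 ^ B"
      using ij M_ge M_le_cells cells_le stride_less by linarith+
    then show "triple (Block [Op Add 11 11 2, Op Add 12 12 2]) rg1 m1 (2 * unit_cost)
        (\<lambda>rg' m'. ctx ip cnt b rg' \<and> rg' 11 = k + i \<and> rg' 12 = k + j \<and> m' = ?m1)"
      using 1 by (intro triple_Block') (simp_all add: ctx_def)
    \<comment> \<open>The second pass reads the result of the first, so the index maps compose in
      reverse order. They act on disjoint bits and commute, which gives the order in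
      \<open>entry_Relabel\<close>.\<close>
    have swap: "copy_bit i j (copy_bit (k + i) (k + j) c) = copy_bit (k + i) (k + j) (copy_bit i j c)" for c
      using ij by (intro bit_eqI) (auto simp: bit_copy_bit)
    have less: "copy_bit (k + i) (k + j) c < cells" "copy_bit i j c < cells" if "c < cells" for c
      using copy_bit_less ij that by simp_all
    have "?m2 (b + c) = entry k (Relabel i j e) c" if "c < cells" for c
      unfolding entry_Relabel[OF e] swap[symmetric]
      using tab less that by (simp add: fill_read table_def)
    then show "triple copy_cmd rg2 m2 (20 * cells * unit_cost)
        (\<lambda>rg' m'. ctx ip cnt b rg' \<and> table b (Relabel i j e) m' \<and> (\<forall>a<b. m' a = m a))"
      if "ctx ip cnt b rg2 \<and> rg2 11 = k + i \<and> rg2 12 = k + j \<and> m2 = ?m1" for rg2 m2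
      using that ij b
      by (intro triple_weaken[OF triple_copy[of ip cnt b rg2 "k + i" "k + j" m2]])
        (auto simp: table_def fill_below)
  qed simp
  show "20 * cells * unit_cost + (2 * unit_cost + 20 * cells * unit_cost) \<le> 45 * cells * unit_cost"
    using cells_pos by (simp add: algebra_simps)
qed

lemma triple_join:
  assumes ctx: "ctx ip cnt b rg" "rg 11 = i" "rg 12 = j" and b: "b + 2 * stride < 2 ^ B"
    and e: "k_expression k (Join i j e)" and tab: "table b e m" and leaves: "num_leaves e \<le> N"
  shows "triple join_cmd rg m (65 * cells * unit_cost)
    (\<lambda>rg' m'. ctx ip cnt b rg' \<and> table b (Join i j e) m' \<and> (\<forall>a<b. m' a = m a))"
  unfolding join_cmd_def
proof (rule triple_Seq')
  let ?f1 = "arcs_update i (k + j) (\<lambda>c. m (b + c))"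
  let ?m1 = "fill b 0 ?f1 m"
  let ?f2 = "arcs_update j (k + i) (\<lambda>c. ?m1 (b + c))"
  let ?m2 = "fill b 0 ?f2 ?m1"
  have ij: "i \<in> {1..k}" "j \<in> {1..k}" using e by auto
  have 0: "m (b + c) < 2 ^ N" if "c < cells" for c using table_less[OF tab leaves that] .
  then have "2 * m (b + c) < 2 ^ B" if "c < cells" for c
    using count_less 0[OF that] by simp
  then show "triple arcs_cmd rg m (30 * cells * unit_cost)
      (\<lambda>rg' m'. ctx ip cnt b rg' \<and> rg' 11 = i \<and> rg' 12 = j \<and> m' = ?m1)"
    using ij b ctx by (intro triple_arcs) auto
  \<comment> \<open>\<open>m\<close> is known to agree with \<open>entry k e\<close> only inside the
    table; \<open>arcs_update_cong\<close> asks for no more than the block of \<open>c\<close>,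
    which lies inside.\<close>
  have f1: "?f1 c = arcs_update i (k + j) (entry k e) c" if "c < cells" for c
    using ij tab same_block_less[OF _ that] by (intro arcs_update_cong[of _ k]) (auto simp: table_def)
  have f2: "?f2 c = arcs_update j (k + i) (arcs_update i (k + j) (entry k e)) c" if "c < cells" for c
    using ij f1 same_block_less[OF _ that] by (intro arcs_update_cong[of _ k]) (auto simp: fill_read)
  have tab2: "?m2 (b + c) = entry k (Join i j e) c" if "c < cells" for c
    using f2[OF that] that by (subst fill_read) (simp only: entry_Join[OF e] if_True simp_thms le0)
  show "triple (Block [Op Add 14 11 0, Op Add 11 12 0, Op Add 12 14 0] ;; arcs_cmd) rg1 m1
      (3 * unit_cost + 30 * cells * unit_cost)
      (\<lambda>rg' m'. ctx ip cnt b rg' \<and> table b (Join i j e) m' \<and> (\<forall>a<b. m' a = m a))"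
    if 1: "ctx ip cnt b rg1 \<and> rg1 11 = i \<and> rg1 12 = j \<and> m1 = ?m1" for rg1 m1
  proof (rule triple_Seq')
    have "i < 2 ^ B" "j < 2 ^ B"
      using ij M_ge M_le_cells cells_le stride_less by auto
    then show "triple (Block [Op Add 14 11 0, Op Add 11 12 0, Op Add 12 14 0]) rg1 m1 (3 * unit_cost)
        (\<lambda>rg' m'. ctx ip cnt b rg' \<and> rg' 11 = j \<and> rg' 12 = i \<and> m' = ?m1)"
      using 1 by (intro triple_Block') (simp_all add: ctx_def)
    \<comment> \<open>The intermediate table belongs to no expression, so only the crude bound
      \<open>2 ^ (N + 1)\<close> is used, and \<open>triple_arcs\<close> doubles it once more. Hence
      the slack in \<open>N + 2 \<le> B\<close>.\<close>
    have small: "2 * ?m1 (b + c) < 2 ^ B" if "c < cells" for c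
    proof -
      have "set_bit (k + j) c < cells" "unset_bit i c < cells"
        using ij that by (auto intro: set_bit_less le_less_trans[OF unset_bit_le])
      then have "?f1 c < 2 ^ N + 2 ^ N"
        using 0 that by (auto simp: arcs_update_def intro: add_less_le_mono less_imp_diff_less less_imp_le trans_less_add1)
      then show ?thesis using count_less that by (simp add: fill_read)
    qed
    show "triple arcs_cmd rg2 m2 (30 * cells * unit_cost)
        (\<lambda>rg' m'. ctx ip cnt b rg' \<and> table b (Join i j e) m' \<and> (\<forall>a<b. m' a = m a))"
      if "ctx ip cnt b rg2 \<and> rg2 11 = j \<and> rg2 12 = i \<and> m2 = ?m1" for rg2 m2
      using that ij b small
      by (intro triple_weaken[OF triple_arcs[of ip cnt b rg2 j i m2]])
        (use tab2 in \<open>auto simp: table_def fill_below\<close>)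
  qed simp
  show "30 * cells * unit_cost + (3 * unit_cost + 30 * cells * unit_cost) \<le> 65 * cells * unit_cost"
    using cells_pos by (simp add: algebra_simps)
qed

lemma triple_union_table:
  assumes ctx: "ctx ip cnt (b + stride) rg" and b: "stride \<le> b" "b + 3 * stride < 2 ^ B"
    and e: "k_expression k (Union e e')" and tab: "table b e m" "table (b + stride) e' m"
    and leaves: "num_leaves (Union e e') \<le> N"
  shows "triple union_cmd rg m (30 * cells * (N + 1) * (unit_cost + mul_cost))
    (\<lambda>rg' m'. ctx ip cnt b rg' \<and> table b (Union e e') m' \<and> (\<forall>a<b. m' a = m a))"
proof -
  let ?f = "convolution (\<lambda>c. m (b + c)) (\<lambda>c. m (b + stride + c))"
  have conv: "?f c = entry k (Union e e') c" if "c < cells" for c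
  proof -
    have p: "c mod M < M" using M_pos by simp
    have index: "a * M + c mod M < cells" if "a \<le> c div M" for a
      using that \<open>c < cells\<close> p by (simp add: less_cells_iff)
    have "?f c = (\<Sum>a\<le>c div M. entry k e (a * M + c mod M) * entry k e' ((c div M - a) * M + c mod M))"
      unfolding convolution_def using tab index by (intro sum.cong) (auto simp: table_def)
    also have "\<dots> = entry k (Union e e') (c div M * M + c mod M)"
      using entry_Union[OF e, of "c mod M" "c div M"] p by (simp add: M_def)
    finally show ?thesis by simp
  qed
  show ?thesis
  proof (rule triple_weaken[OF triple_union[OF ctx b]])
    show "m (b + c) < 2 ^ N" "m (b + stride + c) < 2 ^ N" if "c < cells" for c
      using table_less[OF tab(1) _ that] table_less[OF tab(2) _ that] leaves by simp_all
    show "?f c < 2 ^ N" if "c < cells" for c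
      using conv[OF that] entry_less[OF leaves] by simp
  qed (auto simp: table_def fill_below fill_read conv)
qed

text \<open>The overhead 15 consists of seven instructions for fetching, at most three branchings at
  2 each, and at most two decrements of the opcode.\<close>

lemma triple_op:
  assumes ctx: "ctx ip (Suc x) b rg" and ip: "ip + 3 \<le> stride"
    and branch: "\<And>rg'. ctx (ip + 3) x b rg' \<Longrightarrow> rg' 11 = m (ip + 1) \<Longrightarrow> rg' 12 = m (ip + 2) \<Longrightarrow>
      triple (if m ip = 0 then vertex_cmd else if m ip = 1 then relabel_cmd else
        if m ip = 2 then join_cmd else union_cmd) rg' m T Q"
  shows "triple op_cmd rg m (T + 15 * unit_cost) Q"
  unfolding op_cmd_def
proof (rule triple_Seq')
  let ?R = "\<lambda>rg' m'. ctx (ip + 3) x b rg' \<and> rg' 11 = m (ip + 1) \<and> rg' 12 = m (ip + 2) \<and> m' = m"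
  show "triple (Block [Op Sub 8 8 1, Load 10 7, Op Add 7 7 1, Load 11 7, Op Add 7 7 1, Load 12 7, Op Add 7 7 1])
      rg m (7 * unit_cost) (\<lambda>rg' m'. ?R rg' m' \<and> rg' 10 = m ip)"
    using ctx ip stride_less by (intro triple_Block') (simp_all add: ctx_def eval_nat_numeral)
  show "triple (Cond 10 (Block [Op Sub 10 10 1] ;;
      Cond 10 (Block [Op Sub 10 10 1] ;; Cond 10 union_cmd join_cmd) relabel_cmd) vertex_cmd) rg1 m1
      (T + 8 * unit_cost) Q" if 1: "?R rg1 m1 \<and> rg1 10 = m ip" for rg1 m1
  proof (rule triple_Cond')
    assume "rg1 10 \<noteq> 0"
    show "triple (Block [Op Sub 10 10 1] ;;
      Cond 10 (Block [Op Sub 10 10 1] ;; Cond 10 union_cmd join_cmd) relabel_cmd) rg1 m1 (T + 6 * unit_cost) Q"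
    proof (rule triple_Seq')
      show "triple (Block [Op Sub 10 10 1]) rg1 m1 unit_cost (\<lambda>rg' m'. ?R rg' m' \<and> rg' 10 = m ip - 1)"
        using 1 by (intro triple_Block') (simp_all add: ctx_def)
      show "triple (Cond 10 (Block [Op Sub 10 10 1] ;; Cond 10 union_cmd join_cmd) relabel_cmd) rg2 m2
        (T + 5 * unit_cost) Q" if 2: "?R rg2 m2 \<and> rg2 10 = m ip - 1" for rg2 m2
      proof (rule triple_Cond')
        assume "rg2 10 \<noteq> 0"
        show "triple (Block [Op Sub 10 10 1] ;; Cond 10 union_cmd join_cmd) rg2 m2 (T + 3 * unit_cost) Q"
        proof (rule triple_Seq')
          show "triple (Block [Op Sub 10 10 1]) rg2 m2 unit_cost (\<lambda>rg' m'. ?R rg' m' \<and> rg' 10 = m ip - 2)"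
            using 2 by (intro triple_Block') (simp_all add: ctx_def)
          show "triple (Cond 10 union_cmd join_cmd) rg3 m3 (T + 2 * unit_cost) Q"
            if 3: "?R rg3 m3 \<and> rg3 10 = m ip - 2" for rg3 m3
          proof (rule triple_Cond')
            show "triple union_cmd rg3 m3 T Q" if "rg3 10 \<noteq> 0"
              using branch[of rg3] 3 that by (simp split: if_splits)
            show "triple join_cmd rg3 m3 T Q" if "rg3 10 = 0"
              using branch[of rg3] 3 that \<open>rg2 10 \<noteq> 0\<close> 2 by (simp split: if_splits)
          qed simp
        qed simp
      next
        assume "rg2 10 = 0"
        then show "triple relabel_cmd rg2 m2 (T + 3 * unit_cost) Q"
          using branch[of rg2] 2 \<open>rg1 10 \<noteq> 0\<close> 1
          by - (rule triple_weaken[where T = T and R = Q]; simp split: if_splits)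
      qed simp
    qed simp
  next
    assume "rg1 10 = 0"
    then show "triple vertex_cmd rg1 m1 (T + 6 * unit_cost) Q"
      using branch[of rg1] 1 by - (rule triple_weaken[where T = T and R = Q]; simp)
  qed simp
qed simp

text \<open>The factor 90 leaves room for a join with 65, plus 15 for decoding and 2 for the loop,
  as a table has at least one cell.\<close>

definition op_bound :: nat where "op_bound = 90 * cells * unit_cost"
definition union_bound :: nat where "union_bound = 30 * cells * (N + 1) * (unit_cost + mul_cost)"

fun expr_bound :: "kexp \<Rightarrow> nat" where
  "expr_bound (Vertex i) = op_bound"
| "expr_bound (Relabel i j e) = expr_bound e + op_bound"
| "expr_bound (Join i j e) = expr_bound e + op_bound"
| "expr_bound (Union e e') = expr_bound e + expr_bound e' + op_bound + union_bound"

text \<open>An expression has one union fewer than leaves; the extra \<open>union_bound\<close> on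
  the left says this without subtraction and carries the induction.\<close>

lemma expr_bound_le: "expr_bound e + union_bound \<le> num_ops e * op_bound + num_leaves e * union_bound"
  by (induction e) (auto simp: algebra_simps)

text \<open>
  The last premise describes the remaining execution, so that the loop over all operations can be
  followed by structural induction on the expression.
\<close>

lemma triple_expression:
  assumes "k_expression k e" "ctx ip (num_ops e + x) b rg"
    and "\<forall>n<length (postfix e). m (ip + n) = postfix e ! n" "ip + 3 * num_ops e \<le> stride"
    and "b + (num_ops e + 2) * stride < 2 ^ B" "num_leaves e \<le> N"
    and "\<And>rg' m'. ctx (ip + 3 * num_ops e) x (b + stride) rg' \<Longrightarrow> table (b + stride) e m' \<Longrightarrow>
      \<forall>a<b + stride. m' a = m a \<Longrightarrow> triple (While 8 op_cmd) rg' m' T Q"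
  shows "triple (While 8 op_cmd) rg m (expr_bound e + T) Q"
  using assms
proof (induction e arbitrary: ip x b rg m T)
  case (Vertex i)
  have mem: "m ip = 0" "m (ip + 1) = i" using Vertex.prems(3)[rule_format, of 0] Vertex.prems(3)[rule_format, of 1]
    by simp_all
  have "triple (While 8 op_cmd) rg m ((20 * cells * unit_cost + 15 * unit_cost) + T + 2 * unit_cost) Q"
  proof (rule triple_While_step)
    show "rg 8 \<noteq> 0" using Vertex.prems(2) by (simp add: ctx_def)
    show "triple op_cmd rg m (20 * cells * unit_cost + 15 * unit_cost)
      (\<lambda>rg' m'. ctx (ip + 3) x (b + stride) rg' \<and> m' = fill (b + stride) 0 (entry k (Vertex i)) m)"
      by (rule triple_op[of _ x b]) (use Vertex.prems mem in \<open>auto intro!: triple_vertex\<close>)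
  qed (use Vertex.prems(7) in \<open>auto simp: table_def fill_read fill_below\<close>)
  then show ?case
    by (rule triple_weaken) (use cells_pos in \<open>simp_all add: op_bound_def algebra_simps\<close>)
next
  case (Relabel i j e)
  have last: "m (ip + 3 * num_ops e) = 1" "m (ip + 3 * num_ops e + 1) = i" "m (ip + 3 * num_ops e + 2) = j"
    using nth_postfix_last[of "postfix e" 1 i j m ip] Relabel.prems(3) by (simp_all add: length_postfix)
  have room: "b + stride + 2 * stride < 2 ^ B"
  proof -
    have "3 * stride \<le> (num_ops (Relabel i j e) + 2) * stride" by (intro mult_le_mono1) simp
    then show ?thesis using Relabel.prems(5) by linarith
  qed
  have "triple (While 8 op_cmd) rg m (expr_bound e + (op_bound + T)) Q"
  proof (rule Relabel.IH[of ip "Suc x" b])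
    fix rg1 m1 assume 1: "ctx (ip + 3 * num_ops e) (Suc x) (b + stride) rg1" "table (b + stride) e m1"
      "\<forall>a<b + stride. m1 a = m a"
    let ?ip = "ip + 3 * num_ops e"
    have m1: "m1 ?ip = 1" "m1 (?ip + 1) = i" "m1 (?ip + 2) = j"
      using last 1(3) Relabel.prems(4) by simp_all
    have "triple (While 8 op_cmd) rg1 m1 ((45 * cells * unit_cost + 15 * unit_cost) + T + 2 * unit_cost) Q"
    proof (rule triple_While_step)
      show "rg1 8 \<noteq> 0" using 1 by (simp add: ctx_def)
      show "triple op_cmd rg1 m1 (45 * cells * unit_cost + 15 * unit_cost)
        (\<lambda>rg' m'. ctx (?ip + 3) x (b + stride) rg' \<and> table (b + stride) (Relabel i j e) m' \<and>
          (\<forall>a<b + stride. m' a = m1 a))" (is "triple _ _ _ _ ?R")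
      proof (rule triple_op[of _ x "b + stride"])
        fix rg' assume r: "ctx (?ip + 3) x (b + stride) rg'" "rg' 11 = m1 (?ip + 1)" "rg' 12 = m1 (?ip + 2)"
        have "triple relabel_cmd rg' m1 (45 * cells * unit_cost) ?R"
          by (rule triple_relabel) (use r m1 room 1(2) Relabel.prems in simp_all)
        then show "triple (if m1 ?ip = 0 then vertex_cmd else if m1 ?ip = 1 then relabel_cmd else
            if m1 ?ip = 2 then join_cmd else union_cmd) rg' m1 (45 * cells * unit_cost) ?R"
          by (simp add: m1)
      qed (use 1 Relabel.prems in simp_all)
    qed (use Relabel.prems(7) 1 in \<open>auto simp: algebra_simps\<close>)
    then show "triple (While 8 op_cmd) rg1 m1 (op_bound + T) Q"
      by (rule triple_weaken) (use cells_pos in \<open>simp_all add: op_bound_def algebra_simps\<close>)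
  qed (use Relabel.prems in \<open>auto simp: nth_append\<close>)
  then show ?case by (simp add: add.assoc)
next
  case (Join i j e)
  have last: "m (ip + 3 * num_ops e) = 2" "m (ip + 3 * num_ops e + 1) = i" "m (ip + 3 * num_ops e + 2) = j"
    using nth_postfix_last[of "postfix e" 2 i j m ip] Join.prems(3) by (simp_all add: length_postfix)
  have room: "b + stride + 2 * stride < 2 ^ B"
  proof -
    have "3 * stride \<le> (num_ops (Join i j e) + 2) * stride" by (intro mult_le_mono1) simp
    then show ?thesis using Join.prems(5) by linarith
  qed
  have "triple (While 8 op_cmd) rg m (expr_bound e + (op_bound + T)) Q"
  proof (rule Join.IH[of ip "Suc x" b])
    fix rg1 m1 assume 1: "ctx (ip + 3 * num_ops e) (Suc x) (b + stride) rg1" "table (b + stride) e m1"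
      "\<forall>a<b + stride. m1 a = m a"
    let ?ip = "ip + 3 * num_ops e"
    have m1: "m1 ?ip = 2" "m1 (?ip + 1) = i" "m1 (?ip + 2) = j"
      using last 1(3) Join.prems(4) by simp_all
    have "triple (While 8 op_cmd) rg1 m1 ((65 * cells * unit_cost + 15 * unit_cost) + T + 2 * unit_cost) Q"
    proof (rule triple_While_step)
      show "rg1 8 \<noteq> 0" using 1 by (simp add: ctx_def)
      show "triple op_cmd rg1 m1 (65 * cells * unit_cost + 15 * unit_cost)
        (\<lambda>rg' m'. ctx (?ip + 3) x (b + stride) rg' \<and> table (b + stride) (Join i j e) m' \<and>
          (\<forall>a<b + stride. m' a = m1 a))" (is "triple _ _ _ _ ?R")
      proof (rule triple_op[of _ x "b + stride"])
        fix rg' assume r: "ctx (?ip + 3) x (b + stride) rg'" "rg' 11 = m1 (?ip + 1)" "rg' 12 = m1 (?ip + 2)"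
        have "triple join_cmd rg' m1 (65 * cells * unit_cost) ?R"
          by (rule triple_join) (use r m1 room 1(2) Join.prems in simp_all)
        then show "triple (if m1 ?ip = 0 then vertex_cmd else if m1 ?ip = 1 then relabel_cmd else
            if m1 ?ip = 2 then join_cmd else union_cmd) rg' m1 (65 * cells * unit_cost) ?R"
          by (simp add: m1)
      qed (use 1 Join.prems in simp_all)
    qed (use Join.prems(7) 1 in \<open>auto simp: algebra_simps\<close>)
    then show "triple (While 8 op_cmd) rg1 m1 (op_bound + T) Q"
      by (rule triple_weaken) (use cells_pos in \<open>simp_all add: op_bound_def algebra_simps\<close>)
  qed (use Join.prems in \<open>auto simp: nth_append\<close>)
  then show ?case by (simp add: add.assoc)
next
  case (Union e e')
  let ?n = "num_ops e" and ?n' = "num_ops e'"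
  have mem: "\<forall>n<length (postfix e). m (ip + n) = postfix e ! n"
    "\<forall>n<length (postfix e'). m (ip + 3 * ?n + n) = postfix e' ! n"
    using Union.prems(3) by (auto simp: nth_append length_postfix add.assoc)
  have last: "m (ip + 3 * (?n + ?n')) = 3"
    using nth_postfix_last[of "postfix e @ postfix e'" 3 0 0 m ip] Union.prems(3)
    by (simp add: length_postfix)
  have "triple (While 8 op_cmd) rg m (expr_bound e + (expr_bound e' + (op_bound + union_bound + T))) Q"
  proof (rule Union.IH(1)[of ip "?n' + Suc x" b])
    fix rg1 m1 assume 1: "ctx (ip + 3 * ?n) (?n' + Suc x) (b + stride) rg1" "table (b + stride) e m1"
      "\<forall>a<b + stride. m1 a = m a"
    show "triple (While 8 op_cmd) rg1 m1 (expr_bound e' + (op_bound + union_bound + T)) Q"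
    proof (rule Union.IH(2)[of "ip + 3 * ?n" "Suc x" "b + stride"])
      show "\<forall>n<length (postfix e'). m1 (ip + 3 * ?n + n) = postfix e' ! n"
        using mem(2) 1(3) Union.prems(4) by (simp add: length_postfix)
      fix rg2 m2 assume 2: "ctx (ip + 3 * ?n + 3 * ?n') (Suc x) (b + stride + stride) rg2"
        "table (b + stride + stride) e' m2" "\<forall>a<b + stride + stride. m2 a = m1 a"
      let ?ip = "ip + 3 * ?n + 3 * ?n'"
      have m2: "m2 ?ip = 3" using last 1(3) 2(3) Union.prems(4) by (simp add: algebra_simps)
      \<comment> \<open>The run of the right part alters nothing below
        \<open>b + 2 * stride\<close>, and the left table ends there at the latest since
        \<open>cells \<le> stride\<close>.\<close>
      have tab: "table (b + stride) e m2"
        using 1(2) 2(3) cells_le by (simp add: table_def)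
      have room: "b + stride + 3 * stride < 2 ^ B"
      proof -
        have "num_ops e \<ge> 1" "num_ops e' \<ge> 1" by (cases e; simp) (cases e'; simp)
        then have "4 * stride \<le> (num_ops (Union e e') + 2) * stride" by (intro mult_le_mono1) simp
        then show ?thesis using Union.prems(5) by linarith
      qed
      have "triple (While 8 op_cmd) rg2 m2 ((union_bound + 15 * unit_cost) + T + 2 * unit_cost) Q"
      proof (rule triple_While_step)
        show "rg2 8 \<noteq> 0" using 2 by (simp add: ctx_def)
        show "triple op_cmd rg2 m2 (union_bound + 15 * unit_cost)
          (\<lambda>rg' m'. ctx (?ip + 3) x (b + stride) rg' \<and> table (b + stride) (Union e e') m' \<and>
            (\<forall>a<b + stride. m' a = m2 a))"
        proof (rule triple_op[of _ x "b + stride + stride"])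
          fix rg' assume "ctx (?ip + 3) x (b + stride + stride) rg'"
          then have "triple union_cmd rg' m2 union_bound
            (\<lambda>rg' m'. ctx (?ip + 3) x (b + stride) rg' \<and> table (b + stride) (Union e e') m' \<and>
              (\<forall>a<b + stride. m' a = m2 a))"
            unfolding union_bound_def
            by (rule triple_union_table) (use room tab 2(2) Union.prems in simp_all)
          then show "triple (if m2 ?ip = 0 then vertex_cmd else if m2 ?ip = 1 then relabel_cmd else
              if m2 ?ip = 2 then join_cmd else union_cmd) rg' m2 union_bound
            (\<lambda>rg' m'. ctx (?ip + 3) x (b + stride) rg' \<and> table (b + stride) (Union e e') m' \<and>
              (\<forall>a<b + stride. m' a = m2 a))"
            by (simp add: m2)
        qed (use 2 Union.prems in \<open>simp_all add: algebra_simps\<close>)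
      qed (use Union.prems(7) 1 2 in \<open>auto simp: algebra_simps\<close>)
      then show "triple (While 8 op_cmd) rg2 m2 (op_bound + union_bound + T) Q"
        by (rule triple_weaken) (use cells_pos in \<open>simp_all add: op_bound_def algebra_simps\<close>)
    qed (use Union.prems 1 in \<open>auto simp: algebra_simps\<close>)
  qed (use Union.prems mem in \<open>auto simp: algebra_simps\<close>)
  then show ?case by (simp add: add.assoc)
qed

section \<open>Initialisation, output and the complete program\<close>

lemma triple_init:
  assumes rg: "rg = (\<lambda>_. 0)" and m: "m 0 = k" "m 1 = L"
    and leaves: "(\<Sum>n<L. 1 - m (2 + 3 * n)) = N"
  shows "triple init_cmd rg m ((20 + 8 * L) * unit_cost) (\<lambda>rg' m'. ctx 2 L 0 rg' \<and> m' = m)"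
  unfolding init_cmd_def
proof (rule triple_Seq')
  let ?R = "\<lambda>rg'. rg' 0 = 0 \<and> rg' 1 = 1 \<and> rg' 2 = k \<and> rg' 3 = 2 * k + 1 \<and> rg' 4 = M \<and>
    rg' 5 = stride \<and> rg' 8 = L \<and> rg' 9 = (0::nat)"
  let ?I = "\<lambda>q rg' m'. ?R rg' \<and> q \<le> L \<and> rg' 13 = q \<and> rg' 7 = 2 + 3 * (L - q) \<and>
    rg' 6 = 1 + (\<Sum>n<L - q. 1 - m (2 + 3 * n)) \<and> m' = m"
  have "x \<le> x * M" for x using M_pos by simp
  then have "3 * L + 2 \<le> stride" "N + 1 \<le> cells" unfolding stride_def cells_def by blast+
  then have facts: "M \<ge> 4" "M \<le> stride" "3 * L + 2 \<le> stride" "3 * stride < 2 ^ B" "N + 1 \<le> stride"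
    using M_ge k M_le_cells cells_le stride_less by linarith+
  have shl: "push_bit (Suc (2 * k)) (Suc 0) = M" "push_bit (Suc (2 * k)) (Suc (Suc (3 * L))) = stride"
    "push_bit (Suc (2 * k)) (Suc N) = cells"
    by (simp_all add: M_def stride_def cells_def push_bit_eq_mult)
  have "L + L + L = 3 * L" by simp
  then show "triple (Block [Const 1 1, Load 2 0, Load 8 1, Op Add 3 2 2, Op Add 3 3 1, Op Shl 4 1 3,
       Op Add 5 8 8, Op Add 5 5 8, Op Add 5 5 1, Op Add 5 5 1, Op Shl 5 5 3,
       Const 7 2, Const 6 1, Op Add 13 8 0]) rg m (14 * unit_cost) (?I L)"
    using facts M_ge shl m rg by (intro triple_Block') (simp_all add: mult_2[symmetric])
  show "triple (While 13 (Block [Op Sub 13 13 1, Load 10 7, Op Sub 14 1 10, Op Add 6 6 14, Const 14 3, Op Add 7 7 14]) ;;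
     Block [Op Shl 6 6 3, Const 7 2]) rg1 m1 ((L * (6 * unit_cost + 2 * unit_cost) + unit_cost) + 2 * unit_cost)
     (\<lambda>rg' m'. ctx 2 L 0 rg' \<and> m' = m)" if 1: "?I L rg1 m1" for rg1 m1
  proof (rule triple_Seq'[where R = "?I 0"])
    show "triple (While 13 (Block [Op Sub 13 13 1, Load 10 7, Op Sub 14 1 10, Op Add 6 6 14, Const 14 3, Op Add 7 7 14]))
      rg1 m1 (L * (6 * unit_cost + 2 * unit_cost) + unit_cost) (?I 0)"
    proof (rule triple_While_countdown[where I = ?I], fact 1)
      show "rg' 13 = q" if "?I q rg' m'" for q rg' m' using that by simp
      show "triple (Block [Op Sub 13 13 1, Load 10 7, Op Sub 14 1 10, Op Add 6 6 14, Const 14 3, Op Add 7 7 14])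
        rg2 m2 (6 * unit_cost) (?I q)" if q: "q < L" and I: "?I (Suc q) rg2 m2" for q rg2 m2
      proof -
        have eq: "L - q = Suc (L - Suc q)" using q by simp
        have "(\<Sum>n<L - q. 1 - m (2 + 3 * n)) \<le> (\<Sum>n<L. 1 - m (2 + 3 * n))"
          by (rule sum_mono2) auto
        then have "(\<Sum>n<L - Suc q. 1 - m (2 + 3 * n)) + (1 - m (2 + 3 * (L - Suc q))) \<le> N"
          unfolding leaves eq by simp
        moreover have "2 + 3 * (L - Suc q) + 3 < 2 ^ B" "3 < (2::nat) ^ B" using facts q by linarith+
        ultimately show ?thesis
          using I facts q unfolding eq by (intro triple_Block') (simp_all add: eq)
      qed
    qed
    show "triple (Block [Op Shl 6 6 3, Const 7 2]) rg2 m2 (2 * unit_cost)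
      (\<lambda>rg' m'. ctx 2 L 0 rg' \<and> m' = m)" if 2: "?I 0 rg2 m2" for rg2 m2
    proof -
      have "rg2 6 = Suc N" using 2 leaves by simp
      then show ?thesis
        using 2 facts shl cells_le by (intro triple_Block') (simp_all add: ctx_def)
    qed
  qed simp
qed (simp add: algebra_simps)

lemma triple_output:
  assumes ctx: "ctx ip x stride rg" and e: "k_expression k e" and tab: "table stride e m"
  shows "triple output_cmd rg m ((10 + 7 * (N + 1)) * unit_cost)
    (\<lambda>rg' m'. \<forall>\<kappa>\<le>N. m' \<kappa> = expr_count k e \<kappa> (2 ^ (k + 1) - 1))"
proof -
  define p where "p = (2 ^ (k + 1) - 1 :: nat)"
  \<comment> \<open>Only addresses up to \<open>N\<close>, all below \<open>stride\<close>, are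
    overwritten, so the table being read stays intact.\<close>
  let ?I = "\<lambda>q rg' m'. ctx ip x stride rg' \<and> rg' 13 = q \<and> rg' 14 = p + stride \<and> q \<le> N + 1 \<and>
    (\<forall>\<kappa>. q \<le> \<kappa> \<and> \<kappa> \<le> N \<longrightarrow> m' \<kappa> = expr_count k e \<kappa> p) \<and> (\<forall>a\<ge>stride. m' a = m a)"
  have pow: "2 ^ (k + 1) < 2 * M"
    using pow_less_M[of k] by simp
  have p_less: "p < M" unfolding M_def p_def
    using k by (intro less_le_trans[OF diff_less power_increasing]) auto
  have "x \<le> x * M" for x using M_pos by simp
  then have "N + 1 \<le> cells" unfolding cells_def .
  then have facts: "M \<ge> 4" "M \<le> cells" "cells \<le> stride" "3 * stride < 2 ^ B" "N + 1 \<le> cells"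
    using M_ge k M_le_cells cells_le stride_less by linarith+
  have N_div: "cells div M = N + 1" using M_pos by (simp add: cells_def)
  show ?thesis
    unfolding output_cmd_def p_def[symmetric]
  proof (rule triple_Seq')
    have "k + 1 < 2 ^ B" "p + stride < 2 ^ B" using facts p_less M_ge by linarith+
    moreover have "2 ^ (k + 1) < (2::nat) ^ B" using pow facts by linarith
    ultimately show "triple (Block [Op Add 14 2 1, Op Shl 14 1 14, Op Sub 14 14 1, Op Add 14 14 9, Op Shr 13 6 3]) rg m
        (5 * unit_cost) (?I (N + 1))"
      using ctx facts
      by (intro triple_Block') (simp_all add: ctx_def drop_bit_eq_div_M N_div push_bit_eq_mult p_def)
    show "triple (While 13 (Block [Op Sub 13 13 1, Op Shl 15 13 3, Op Add 15 15 14, Load 15 15, Store 13 15])) rg1 m1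
        ((N + 1) * (5 * unit_cost + 2 * unit_cost) + unit_cost)
        (\<lambda>rg' m'. \<forall>\<kappa>\<le>N. m' \<kappa> = expr_count k e \<kappa> p)" if 1: "?I (N + 1) rg1 m1" for rg1 m1
    proof (rule triple_weaken[OF triple_While_countdown[where I = ?I]], fact 1)
      show "rg' 13 = q" if "?I q rg' m'" for q rg' m' using that by simp
      show "triple (Block [Op Sub 13 13 1, Op Shl 15 13 3, Op Add 15 15 14, Load 15 15, Store 13 15]) rg2 m2
        (5 * unit_cost) (?I q)" if q: "q < N + 1" and I: "?I (Suc q) rg2 m2" for q rg2 m2
      proof -
        have index: "q * M + p < cells"
          using q p_less by (simp add: less_cells_iff)
        then have "m2 (q * M + (p + stride)) = m (stride + (q * M + p))"
          using I by (simp add: ac_simps)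
        also have "\<dots> = expr_count k e q p"
          using tab index entry_index[OF e, of p q] p_less by (simp add: table_def M_def)
        finally have val: "m2 (q * M + (p + stride)) = expr_count k e q p" .
        have shl: "push_bit (2 * k) (q * 2) = q * M" by (simp add: M_def push_bit_eq_mult)
        have less: "q * M + (p + stride) < 2 ^ B" "q * M < 2 ^ B" "q < stride"
          using index facts q by linarith+
        have "\<forall>\<kappa>. q \<le> \<kappa> \<and> \<kappa> \<le> N \<longrightarrow> (m2(q := expr_count k e q p)) \<kappa> = expr_count k e \<kappa> p"
          using I by (metis fun_upd_apply not_less_eq_eq order_antisym)
        moreover have "\<forall>a\<ge>stride. (m2(q := expr_count k e q p)) a = m a"
          using I less by auto
        ultimately show ?thesis
          using I q val less by (intro triple_Block') (simp_all add: ctx_def shl)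
      qed
    qed auto
  qed (simp add: algebra_simps)
qed

text \<open>Initialisation and output take time linear in \<open>L\<close> and \<open>N\<close>;
  since \<open>N + 1 \<le> cells\<close>, a second copy of \<open>L * op_bound\<close> absorbs
  both.\<close>

lemma triple_main:
  assumes e: "k_expression k e" and L: "L = num_ops e" and N: "N = num_leaves e"
  shows "triple main_cmd (\<lambda>_. 0) (mem (initial (input k e))) (2 * L * op_bound + N * union_bound)
    (\<lambda>rg' m'. \<forall>\<kappa>\<le>N. m' \<kappa> = expr_count k e \<kappa> (2 ^ (k + 1) - 1))"
proof -
  let ?m = "mem (initial (input k e))"
  have m: "?m 0 = k" "?m 1 = L" "\<And>n. n < length (postfix e) \<Longrightarrow> ?m (2 + n) = postfix e ! n"
    using L by (auto simp: initial_def input_def)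
  have L1: "L \<ge> 1" unfolding L by (cases e) auto
  have len: "length (postfix e) = 3 * L" using L by (simp add: length_postfix)
  have sum: "(\<Sum>n<L. 1 - ?m (2 + 3 * n)) = N"
    using sum_opcodes[of e] m(3) L N len by simp
  have "triple main_cmd (\<lambda>_. 0) ?m
     ((20 + 8 * L) * unit_cost + (expr_bound e + unit_cost + (10 + 7 * (N + 1)) * unit_cost))
     (\<lambda>rg' m'. \<forall>\<kappa>\<le>N. m' \<kappa> = expr_count k e \<kappa> (2 ^ (k + 1) - 1))" (is "triple _ _ _ _ ?Q")
    unfolding main_cmd_def
  proof (rule triple_Seq)
    show "triple init_cmd (\<lambda>_. 0) ?m ((20 + 8 * L) * unit_cost) (\<lambda>rg' m'. ctx 2 L 0 rg' \<and> m' = ?m)"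
      using m sum L1 len by (intro triple_init) auto
    show "triple (While 8 op_cmd ;; output_cmd) rg1 m1
      (expr_bound e + unit_cost + (10 + 7 * (N + 1)) * unit_cost) ?Q"
      if 1: "ctx 2 L 0 rg1 \<and> m1 = ?m" for rg1 m1
    proof (rule triple_Seq)
      let ?R = "\<lambda>rg' m'. ctx (2 + 3 * L) 0 stride rg' \<and> table stride e m'"
      show "triple (While 8 op_cmd) rg1 m1 (expr_bound e + unit_cost) ?R"
      proof (rule triple_expression[OF e, of 2 0 0])
        have "x \<le> x * M" for x using M_pos by simp
        from this[of "3 * L + 2"] show "2 + 3 * num_ops e \<le> stride"
          unfolding stride_def L[symmetric] by simp
        show "0 + (num_ops e + 2) * stride < 2 ^ B"
        proof -
          have "(L + 2) * stride \<le> (L + 3) * stride" by (intro mult_le_mono1) simp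
          then show ?thesis using space unfolding L[symmetric] stride_def M_def by linarith
        qed
        show "triple (While 8 op_cmd) rg' m' unit_cost ?R"
          if "ctx (2 + 3 * num_ops e) 0 (0 + stride) rg'" "table (0 + stride) e m'" for rg' m'
          using that unfolding L[symmetric] by (intro triple_While_done) (simp_all add: ctx_def)
      qed (use 1 m N L in auto)
      show "triple output_cmd rg2 m2 ((10 + 7 * (N + 1)) * unit_cost) ?Q" if "?R rg2 m2" for rg2 m2
        using triple_output[OF _ e] that by blast
    qed
  qed
  then show ?thesis
  proof (rule triple_weaken)
    have "x \<le> x * M" for x using M_pos by simp
    then have "N + 1 \<le> cells" unfolding cells_def .
    have "(20 + 8 * L) + 1 + (10 + 7 * (N + 1)) \<le> 38 * L * 1 + 1 * 8 * (N + 1)"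
      using L1 by simp
    also have "\<dots> \<le> 38 * L * cells + L * 8 * cells"
      using cells_pos L1 \<open>N + 1 \<le> cells\<close> by (intro add_mono mult_le_mono) auto
    finally have "((20 + 8 * L) + 1 + (10 + 7 * (N + 1))) * unit_cost \<le> (90 * L * cells) * unit_cost"
      by (intro mult_le_mono1) simp
    then have "((20 + 8 * L) + 1 + (10 + 7 * (N + 1))) * unit_cost \<le> L * op_bound"
      unfolding op_bound_def by (simp only: mult_ac)
    moreover have "expr_bound e \<le> L * op_bound + N * union_bound"
      using expr_bound_le[of e] L N by simp
    ultimately show "(20 + 8 * L) * unit_cost + (expr_bound e + unit_cost + (10 + 7 * (N + 1)) * unit_cost)
        \<le> 2 * L * op_bound + N * union_bound"
      by (simp add: algebra_simps)
  qed simp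
qed

end

section \<open>The running time\<close>

lemma set_postfix: "k_expression k e \<Longrightarrow> x \<in> set (postfix e) \<Longrightarrow> x \<le> k \<or> x \<le> 3"
  by (induction e) auto

lemma words_le: "w \<ge> 1 \<Longrightarrow> X \<ge> 1 \<Longrightarrow> b \<le> X * w \<Longrightarrow> words w b \<le> X"
proof -
  assume "w \<ge> 1" "X \<ge> 1" "b \<le> X * w"
  then have "b + w - 1 < (X + 1) * w" by simp
  then have "(b + w - 1) div w < X + 1"
    using \<open>w \<ge> 1\<close> by (simp add: div_less_iff_less_mult)
  with \<open>X \<ge> 1\<close> show ?thesis by (simp add: words_def)
qed

lemma le_words: "w \<ge> 1 \<Longrightarrow> b \<le> words w b * w"
proof -
  assume w: "w \<ge> 1"
  have "b + w - 1 < ((b + w - 1) div w + 1) * w"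
    using w dividend_less_div_times[of w "b + w - 1"] by (simp add: algebra_simps)
  then have "b \<le> ((b + w - 1) div w) * w" using w by simp
  also have "\<dots> \<le> words w b * w" by (simp add: words_def)
  finally show ?thesis .
qed

text \<open>One program serves all \<open>c\<close>, \<open>d\<close> and inputs, and
  \<open>C\<close> depends on \<open>c\<close> and \<open>d\<close> alone. Correctness is
  unconditional. Redundant relabellings and joins can make an expression arbitrarily long, so the
  time bound refers to expressions with at most \<open>d * n * k ^ 2\<close> operations.\<close>

theorem theorem9:
  "\<exists>P :: program. \<forall>c \<ge> 1. \<forall>d. \<exists>C. \<forall>im k e. \<forall>G :: nat graph.
     multiplication_time im \<longrightarrow> k_expression_for k e G \<longrightarrow>
     (let n = card (verts G); w = c * k in
      \<exists>t s. runs w im P (initial (input k e)) t s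
        \<and> (\<forall>\<kappa> \<le> n. mem s \<kappa> = num_dominating G \<kappa>)
        \<and> (num_ops e \<le> d * n * k ^ 2 \<longrightarrow> t \<le> C * (n ^ 3 * (k ^ 2 + im w n) * 4 ^ k)))"
proof (rule exI[of _ "compile main_cmd 0"], intro allI impI)
  fix c d :: nat assume c: "c \<ge> 1"
  \<comment> \<open>For such expressions \<open>B\<close> will be at most
    \<open>3 * n + 6 * k + 6 * d + 9\<close>, where \<open>n\<close>, \<open>k\<close> and 1 are at
    most \<open>q * w\<close>; so \<open>(6 * d + 18) * q\<close> words suffice.\<close>
  define U where "U = 6 * d + 20"
  show "\<exists>C. \<forall>im k e. \<forall>G :: nat graph.
     multiplication_time im \<longrightarrow> k_expression_for k e G \<longrightarrow>
     (let n = card (verts G); w = c * k in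
      \<exists>t s. runs w im (compile main_cmd 0) (initial (input k e)) t s
        \<and> (\<forall>\<kappa> \<le> n. mem s \<kappa> = num_dominating G \<kappa>)
        \<and> (num_ops e \<le> d * n * k ^ 2 \<longrightarrow> t \<le> C * (n ^ 3 * (k ^ 2 + im w n) * 4 ^ k)))"
  \<comment> \<open>720 is 2 * 90 * 4, from the \<open>op_bound\<close> of all operations, and 240
    is 30 * 4 * 2, from the unions. The factor 4 comes from
    \<open>cells \<le> 4 * n * 4 ^ k\<close>, the last 2 from
    \<open>n + 1 \<le> 2 * n\<close>.\<close>
  proof (rule exI[of _ "720 * d * U + 240 * (U + 1)"], intro allI impI)
    fix im k e and G :: "nat graph"
    assume im: "multiplication_time im" and "k_expression_for k e G"
    then have e: "k_expression k e" and iso: "isomorphic (eval_kexp e) G"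
      by (auto simp: k_expression_for_def)
    have k: "k \<ge> 1" using label_bounds[OF e] verts_nonempty[of e] by fastforce
    \<comment> \<open>Since \<open>b\<close> bits hold \<open>L + 3\<close> as well as
      \<open>3 * L + 2\<close>, all addresses fit into \<open>2 * b + 2 * k + 1\<close> bits; the
      summand \<open>n\<close> is for the counts.\<close>
    define n L w b B where "n = num_leaves e" and "L = num_ops e" and "w = c * k"
      and "b = bits (3 * L + 3)" and "B = n + 2 * b + 2 * k + 3"
    have n: "card (verts G) = n"
      using iso unfolding isomorphic_def n_def card_verts[symmetric] by (metis bij_betw_same_card)
    have n1: "n \<ge> 1" unfolding n_def card_verts[symmetric]
      using finite_verts verts_nonempty by (simp add: Suc_le_eq card_gt_0_iff)
    have w: "w \<ge> 1" and k_le_w: "k \<le> w" using c k by (simp_all add: w_def)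
    have b: "3 * L + 3 < 2 ^ b" using bits_le_iff[of "3 * L + 3" b] by (simp add: b_def)
    have leaves_le: "num_leaves e' \<le> num_ops e'" for e' by (induction e') auto
    interpret counting w im B n k L
    proof
      have "(L + 3) * ((3 * L + 2) * 2 ^ (2 * k + 1)) \<le> 2 ^ b * (2 ^ b * 2 ^ (2 * k + 1))"
        using b by (intro mult_le_mono) auto
      also have "\<dots> < 2 ^ B" unfolding power_add[symmetric] B_def by (intro power_strict_increasing) auto
      finally show "(L + 3) * ((3 * L + 2) * 2 ^ (2 * k + 1)) < 2 ^ B" .
      show "n + 1 \<le> 3 * L + 2" using leaves_le[of e] by (simp add: n_def L_def)
    qed (use w im k in \<open>auto simp: B_def\<close>)
    let ?m = "mem (initial (input k e))"
    have small: "small (\<lambda>_. 0) ?m"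
    proof -
      have k_less: "k < 2 ^ B"
        by (rule less_le_trans[OF less_exp power_increasing]) (simp_all add: B_def)
      have "L < 2 ^ B"
        by (rule less_le_trans[OF _ power_increasing[of b]]) (use b in \<open>simp_all add: B_def\<close>)
      moreover have "(4 :: nat) \<le> 2 ^ B"
        using power_increasing[of 2 B "2 :: nat"] by (simp add: B_def)
      ultimately have "x < 2 ^ B" if "x \<in> set (input k e)" for x
        using that set_postfix[OF e, of x] k_less by (auto simp: input_def L_def)
      then show ?thesis by (simp add: small_def initial_def)
    qed
    have "code_at (compile main_cmd 0) 0 (compile main_cmd 0)"
      unfolding code_at_def by (intro exI[of _ "[]"]) simp
    from tripleE[OF triple_main[OF e L_def n_def] small this]
    obtain t rg' m' where t: "t \<le> 2 * L * op_bound + n * union_bound"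
      and m': "\<forall>\<kappa>\<le>n. m' \<kappa> = expr_count k e \<kappa> (2 ^ (k + 1) - 1)"
      and run: "\<And>t' s'. runs w im (compile main_cmd 0) (cfg (0 + csize main_cmd) rg' m') t' s' \<Longrightarrow>
         runs w im (compile main_cmd 0) (cfg 0 (\<lambda>_. 0) ?m) (t + t') s'"
      by metis
    have "runs w im (compile main_cmd 0) (initial (input k e)) (t + 0) (cfg (0 + csize main_cmd) rg' m')"
      using run[OF runs.halted] by (simp add: initial_def)
    moreover have "m' \<kappa> = num_dominating G \<kappa>" if "\<kappa> \<le> n" for \<kappa>
      using m' that num_dominating_eval[OF e] num_dominating_isomorphic[OF iso edges_subset] by simp
    moreover have "t \<le> (720 * d * U + 240 * (U + 1)) * (n ^ 3 * (k ^ 2 + im w n) * 4 ^ k)"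
      if ops: "num_ops e \<le> d * n * k ^ 2"
    proof -
      \<comment> \<open>The length of a count in words, estimated by \<open>n\<close> in the term
        for \<open>op_bound\<close> and by \<open>im w n\<close> in the term for the unions.\<close>
      define q where "q = words w n"
      have q1: "q \<ge> 1" unfolding q_def by (rule words_ge_1)
      have q_n: "q \<le> n" unfolding q_def using w n1 by (intro words_le) auto
      have q_im: "q \<le> im w n" using im w by (simp add: q_def multiplication_time_def)
      \<comment> \<open>The bound on the number of operations also keeps addresses short: the
        logarithm of \<open>n * k ^ 2\<close> is estimated crudely by
        \<open>n + 2 * k\<close>.\<close>
      have "b \<le> 3 * d + 3 + n + 2 * k"
      proof -
        have "3 * L + 3 \<le> (3 * d + 3) * (n * k ^ 2)"
        proof -
          have "1 * 1 \<le> n * k ^ 2" using n1 k by (intro mult_le_mono) auto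
          then show ?thesis
            using mult_le_mono2[of 1 "n * k ^ 2" 3] ops unfolding L_def add_mult_distrib mult.assoc by linarith
        qed
        also have "\<dots> < 2 ^ (3 * d + 3) * (2 ^ n * (2 ^ k) ^ 2)"
        proof (rule mult_strict_mono')
          show "n * k ^ 2 < 2 ^ n * (2 ^ k) ^ 2"
            using less_exp[of n] less_exp[of k] by (intro mult_strict_mono' power_strict_mono) auto
        qed (use less_exp[of "3 * d + 3"] in simp_all)
        also have "\<dots> = 2 ^ (3 * d + 3 + n + 2 * k)" 
          by (simp only: power_add power_mult[symmetric] mult.commute[of 2 k] mult.assoc)
        finally show ?thesis unfolding b_def bits_le_iff .
      qed
      then have "B \<le> 3 * n + 6 * k + (6 * d + 9)" by (simp add: B_def)
      also have "\<dots> \<le> 3 * (q * w) + 6 * (q * w) + (6 * d + 9) * (q * w)"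
      proof (intro add_mono mult_le_mono2)
        show "n \<le> q * w" using le_words w by (simp add: q_def)
        have "1 * k \<le> q * w" using q1 k_le_w by (intro mult_le_mono) auto
        then show "k \<le> q * w" by simp
        have "1 * 1 \<le> q * w" using q1 w by (intro mult_le_mono) auto
        then show "6 * d + 9 \<le> (6 * d + 9) * (q * w)" by simp
      qed
      also have "\<dots> \<le> (U * q) * w" by (simp add: U_def algebra_simps)
      finally have u: "unit_cost \<le> U * q"
        unfolding unit_cost_def using w q1 by (intro words_le) (auto simp: U_def)
      have "cells \<le> 2 * n * (2 * 4 ^ k)"
        using n1 unfolding cells_def M_def by (intro mult_le_mono) (simp_all add: power_mult)
      then have cells: "cells \<le> 4 * n * 4 ^ k" by simp
      have "2 * L * op_bound \<le> 2 * (d * n * k ^ 2) * (90 * (4 * n * 4 ^ k) * (U * n))"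
        unfolding op_bound_def L_def
        using ops cells u q_n by (intro mult_le_mono) (auto intro: order_trans)
      also have "\<dots> = (720 * d * U) * (n ^ 3 * k ^ 2 * 4 ^ k)"
        by (simp add: power3_eq_cube)
      also have "\<dots> \<le> (720 * d * U) * (n ^ 3 * (k ^ 2 + im w n) * 4 ^ k)"
        by (intro mult_le_mono) auto
      finally have 1: "2 * L * op_bound \<le> \<dots>" .
      have "n * union_bound \<le> n * (30 * (4 * n * 4 ^ k) * (2 * n) * (U * im w n + im w n))"
        unfolding union_bound_def mul_cost_def
        using cells u q_im n1 by (intro mult_le_mono add_mono) (auto intro: order_trans)
      also have "\<dots> = (240 * (U + 1)) * (n ^ 3 * im w n * 4 ^ k)"
        by (simp add: power3_eq_cube algebra_simps)
      also have "\<dots> \<le> (240 * (U + 1)) * (n ^ 3 * (k ^ 2 + im w n) * 4 ^ k)"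
        by (intro mult_le_mono) auto
      finally have "n * union_bound \<le> \<dots>" .
      with 1 t show ?thesis unfolding add_mult_distrib[of "720 * d * U"] by linarith
    qed
    ultimately show "let n = card (verts G); w = c * k in
      \<exists>t s. runs w im (compile main_cmd 0) (initial (input k e)) t s
        \<and> (\<forall>\<kappa> \<le> n. mem s \<kappa> = num_dominating G \<kappa>)
        \<and> (num_ops e \<le> d * n * k ^ 2 \<longrightarrow>
            t \<le> (720 * d * U + 240 * (U + 1)) * (n ^ 3 * (k ^ 2 + im w n) * 4 ^ k))"
      unfolding Let_def n w_def[symmetric]
      by (intro exI[of _ t] exI[of _ "cfg (0 + csize main_cmd) rg' m'"]) simp
  qed
qed

end
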